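(* Let $(G_i,H_i)_{i\in I}$ be a family in which each $G_i$ is a finite non-identity group and $H_i\le G_i$ is a subgroup, and suppose there is a constant $c$ such that $|H_i|\le(\log|G_i|)^c$ for all $i\in I$. Then the family is distinguishable if and only if there is a constant $c'$ such that for every $i\in I$ the group $H_i$ has a non-identity element $h$ with $|h^{G_i}|\le(\log|G_i|)^{c'}$.
   Context: For a finite group $G$, $\mathrm{Irr}(G)$ is the set of complex irreducible representations of $G$ up to equivalence; for $\rho\in \mathrm{Irr}(G)$, $d_\rho$ is its dimension and $\chi_\rho$ its character. For $H\le G$, $$D_H=\frac{1}{|G|}\sum_{\rho\in \mathrm{Irr}(G)} d_\rho\Big|\sum_{h\in H,\,h\ne 1}\chi_\rho(h)\Big|.$$ $h^G$ is the conjugacy class of $h$ in $G$. Distinguishability is an asymptotic notion: a family $(G_i,H_i)$ is distinguishable if there is a constant $b$, independent of $i$, such that $D_{H_i}\ge(\log|G_i|)^{-b}$ for all $i$. *)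

theory Defs
  imports Complex_Main "HOL-Algebra.Coset" "Jordan_Normal_Form.VS_Connect"
begin

section \<open>Complex irreducible representations\<close>

text \<open>
  Finite-dimensional complex representations are taken in matrix form, as homomorphisms
  into the group of units of the ring of complex \<open>n \<times> n\<close> matrices; only the values on
  \<open>carrier G\<close> matter.
\<close>

definition representation :: "('a, 'm) monoid_scheme \<Rightarrow> nat \<Rightarrow> ('a \<Rightarrow> complex mat) \<Rightarrow> bool" where
  "representation G n \<rho> \<longleftrightarrow> \<rho> \<in> hom G (units_of (ring_mat TYPE(complex) n ()))"

definition irreducible_representation ::
    "('a, 'm) monoid_scheme \<Rightarrow> nat \<Rightarrow> ('a \<Rightarrow> complex mat) \<Rightarrow> bool" where
  "irreducible_representation G n \<rho> \<longleftrightarrow>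
     representation G n \<rho> \<and> 0 < n \<and>
     (\<forall>W. subspace class_ring W (module_vec TYPE(complex) n) \<and>
          (\<forall>g\<in>carrier G. \<forall>w\<in>W. \<rho> g *\<^sub>v w \<in> W) \<longrightarrow>
          W = {0\<^sub>v n} \<or> W = carrier_vec n)"

definition irreducible_representations :: "('a, 'm) monoid_scheme \<Rightarrow> ('a \<Rightarrow> complex mat) set" where
  "irreducible_representations G = {\<rho>. \<exists>n. irreducible_representation G n \<rho>}"

text \<open>
  The base change \<open>P\<close> (with inverse \<open>Q\<close>) is the same for all group elements.
\<close>

definition rep_equivalence ::
    "('a, 'm) monoid_scheme \<Rightarrow> (('a \<Rightarrow> complex mat) \<times> ('a \<Rightarrow> complex mat)) set" where
  "rep_equivalence G =
     {(\<rho>, \<sigma>). \<rho> \<in> irreducible_representations G \<and> \<sigma> \<in> irreducible_representations G \<and>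
              (\<exists>P Q. \<forall>g\<in>carrier G. similar_mat_wit (\<rho> g) (\<sigma> g) P Q)}"

definition Irr :: "('a, 'm) monoid_scheme \<Rightarrow> ('a \<Rightarrow> complex mat) set set" where
  "Irr G = irreducible_representations G // rep_equivalence G"

definition mat_trace :: "complex mat \<Rightarrow> complex" where
  "mat_trace A = (\<Sum>i<dim_row A. A $$ (i, i))"

text \<open>
  Dimension and character of an equivalence class are read off a representative; the choice is
  irrelevant, see \<open>irr_dim_eq\<close> and \<open>irr_char_eq\<close> below.
\<close>

definition irr_dim :: "('a, 'm) monoid_scheme \<Rightarrow> ('a \<Rightarrow> complex mat) set \<Rightarrow> nat" where
  "irr_dim G C = dim_row ((SOME \<rho>. \<rho> \<in> C) \<one>\<^bsub>G\<^esub>)"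

definition irr_char :: "('a \<Rightarrow> complex mat) set \<Rightarrow> 'a \<Rightarrow> complex" where
  "irr_char C g = mat_trace ((SOME \<rho>. \<rho> \<in> C) g)"

lemma equiv_rep_equivalence: "equiv (irreducible_representations G) (rep_equivalence G)"
proof (rule equivI)
  show "rep_equivalence G \<subseteq> irreducible_representations G \<times> irreducible_representations G"
    by (auto simp: rep_equivalence_def)
  show "refl_on (irreducible_representations G) (rep_equivalence G)"
  proof (rule refl_onI)
    fix \<rho> assume \<rho>: "\<rho> \<in> irreducible_representations G"
    then obtain n where "representation G n \<rho>"
      by (auto simp: irreducible_representations_def irreducible_representation_def)
    then have "\<forall>g\<in>carrier G. similar_mat_wit (\<rho> g) (\<rho> g) (1\<^sub>m n) (1\<^sub>m n)"
      by (fastforce simp: representation_def hom_def units_of_def Units_def ring_mat_simps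
          intro!: similar_mat_wit_refl)
    with \<rho> show "(\<rho>, \<rho>) \<in> rep_equivalence G"
      by (auto simp: rep_equivalence_def)
  qed
  show "sym (rep_equivalence G)"
  proof (rule symI)
    fix \<rho> \<sigma> assume *: "(\<rho>, \<sigma>) \<in> rep_equivalence G"
    then obtain P Q where "\<forall>g\<in>carrier G. similar_mat_wit (\<rho> g) (\<sigma> g) P Q"
      by (auto simp: rep_equivalence_def)
    then have "\<forall>g\<in>carrier G. similar_mat_wit (\<sigma> g) (\<rho> g) Q P"
      by (simp add: similar_mat_wit_sym)
    with * show "(\<sigma>, \<rho>) \<in> rep_equivalence G"
      by (auto simp: rep_equivalence_def)
  qed
  show "trans (rep_equivalence G)"
  proof (rule transI)
    fix \<rho> \<sigma> \<tau> assume *: "(\<rho>, \<sigma>) \<in> rep_equivalence G" "(\<sigma>, \<tau>) \<in> rep_equivalence G"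
    then obtain P Q P' Q' where
      "\<forall>g\<in>carrier G. similar_mat_wit (\<rho> g) (\<sigma> g) P Q"
      "\<forall>g\<in>carrier G. similar_mat_wit (\<sigma> g) (\<tau> g) P' Q'"
      unfolding rep_equivalence_def by fast
    then have "\<forall>g\<in>carrier G. similar_mat_wit (\<rho> g) (\<tau> g) (P * P') (Q' * Q)"
      using similar_mat_wit_trans by fast
    with * show "(\<rho>, \<tau>) \<in> rep_equivalence G"
      unfolding rep_equivalence_def by fast
  qed
qed

lemma mat_trace_comm:
  assumes "A \<in> carrier_mat n n" "B \<in> carrier_mat n n"
  shows "mat_trace (A * B) = mat_trace (B * A)"
proof -
  have "mat_trace (A * B) = (\<Sum>i<n. \<Sum>j<n. A $$ (i, j) * B $$ (j, i))"
    using assms by (auto simp: mat_trace_def scalar_prod_def atLeast0LessThan intro!: sum.cong)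
  also have "\<dots> = (\<Sum>j<n. \<Sum>i<n. B $$ (j, i) * A $$ (i, j))"
    by (subst sum.swap) (simp add: mult.commute)
  also have "\<dots> = mat_trace (B * A)"
    using assms by (auto simp: mat_trace_def scalar_prod_def atLeast0LessThan intro!: sum.cong)
  finally show ?thesis .
qed

lemma mat_trace_similar:
  assumes "similar_mat_wit A B P Q"
  shows "mat_trace A = mat_trace B"
proof -
  obtain n where n: "A \<in> carrier_mat n n" "B \<in> carrier_mat n n" "P \<in> carrier_mat n n" "Q \<in> carrier_mat n n"
    and QP: "Q * P = 1\<^sub>m n" and A: "A = P * B * Q"
    using similar_mat_witD[OF refl assms] by blast
  have "mat_trace A = mat_trace (P * B * Q)"
    by (simp only: A)
  also have "\<dots> = mat_trace (Q * (P * B))"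
    using n(2-4) by (intro mat_trace_comm[of _ n]) auto
  also have "Q * (P * B) = Q * P * B"
    using n(2-4) by (intro assoc_mult_mat[symmetric])
  also have "\<dots> = B"
    using n(2) by (simp add: QP)
  finally show ?thesis .
qed

lemma rep_equivalence_similar:
  assumes "(\<rho>, \<sigma>) \<in> rep_equivalence G" "g \<in> carrier G"
  shows "\<exists>P Q. similar_mat_wit (\<rho> g) (\<sigma> g) P Q"
  using assms by (auto simp: rep_equivalence_def)

lemma Irr_representative:
  assumes "C \<in> Irr G" "\<rho> \<in> C"
  shows "((SOME \<rho>. \<rho> \<in> C), \<rho>) \<in> rep_equivalence G"
proof -
  have "(SOME \<rho>. \<rho> \<in> C) \<in> C"
    using someI[of "\<lambda>\<rho>. \<rho> \<in> C"] assms(2) by simp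
  then show ?thesis
    using quotient_eq_iff[OF equiv_rep_equivalence, of C G C] assms unfolding Irr_def by simp
qed

lemma irr_dim_eq:
  assumes "group G" "C \<in> Irr G" "\<rho> \<in> C" "representation G n \<rho>"
  shows "irr_dim G C = n"
proof -
  have one: "\<one>\<^bsub>G\<^esub> \<in> carrier G"
    using assms(1) by (simp add: group.is_monoid)
  obtain P Q where "similar_mat_wit ((SOME \<rho>. \<rho> \<in> C) \<one>\<^bsub>G\<^esub>) (\<rho> \<one>\<^bsub>G\<^esub>) P Q"
    using rep_equivalence_similar[OF Irr_representative[OF assms(2,3)] one] by blast
  then have "dim_row ((SOME \<rho>. \<rho> \<in> C) \<one>\<^bsub>G\<^esub>) = dim_row (\<rho> \<one>\<^bsub>G\<^esub>)"
    using similar_mat_witD[OF refl] by (metis carrier_matD(1) insert_subset)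
  moreover have "\<rho> \<one>\<^bsub>G\<^esub> \<in> carrier_mat n n"
    using assms(4) one
    by (auto simp: representation_def hom_def units_of_def Units_def ring_mat_simps)
  ultimately show ?thesis
    by (simp add: irr_dim_def)
qed

lemma irr_char_eq:
  assumes "C \<in> Irr G" "\<rho> \<in> C" "g \<in> carrier G"
  shows "irr_char C g = mat_trace (\<rho> g)"
  using rep_equivalence_similar[OF Irr_representative[OF assms(1,2)] assms(3)] mat_trace_similar
  unfolding irr_char_def by blast


section \<open>Distinguishability\<close>

definition D_measure :: "('a, 'm) monoid_scheme \<Rightarrow> 'a set \<Rightarrow> real" where
  "D_measure G H =
     1 / real (card (carrier G)) *
     (\<Sum>C\<in>Irr G. real (irr_dim G C) * cmod (\<Sum>h\<in>H - {\<one>\<^bsub>G\<^esub>}. irr_char C h))"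

definition conj_class :: "('a, 'm) monoid_scheme \<Rightarrow> 'a \<Rightarrow> 'a set" where
  "conj_class G h = {g \<otimes>\<^bsub>G\<^esub> h \<otimes>\<^bsub>G\<^esub> inv\<^bsub>G\<^esub> g | g. g \<in> carrier G}"

text \<open>
  The parameter \<open>\<beta>\<close> is the base of the logarithm.
\<close>

definition distinguishable ::
    "real \<Rightarrow> 'i set \<Rightarrow> ('i \<Rightarrow> ('a, 'm) monoid_scheme) \<Rightarrow> ('i \<Rightarrow> 'a set) \<Rightarrow> bool" where
  "distinguishable \<beta> I G H \<longleftrightarrow>
     (\<exists>b::real. \<forall>i\<in>I. D_measure (G i) (H i) \<ge> log \<beta> (real (card (carrier (G i)))) powr (- b))"

end

theory Submission
  imports Defs "Jordan_Normal_Form.Spectral_Radius" "HOL-Analysis.L2_Norm" "HOL-Algebra.Multiplicative_Group"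
begin

text \<open>
  Both directions are estimates for a single pair \<open>(G, H)\<close>: for every \<open>h \<noteq> 1\<close> in \<open>H\<close>,
  \<open>1 / |h\<^sup>G| \<le> D\<^sub>H \<le> \<Sum>\<^bsub>k\<in>H, k\<noteq>1\<^esub> |k\<^sup>G|\<^sup>-\<^sup>1\<^sup>/\<^sup>2\<close>.
  The upper bound is the triangle inequality followed by Cauchy--Schwarz, with
  \<open>\<Sum>\<^sub>\<rho> d\<^sub>\<rho>\<^sup>2 = |G|\<close> and \<open>\<Sum>\<^sub>\<rho> |\<chi>\<^sub>\<rho>(k)|\<^sup>2 = |G| / |k\<^sup>G|\<close>; only here does the size of \<open>H\<close> matter.
  For the lower bound, replace the weight \<open>d\<^sub>\<rho>\<close> by the smaller \<open>|\<chi>\<^sub>\<rho>(h\<^sup>-\<^sup>1)|\<close>, move the absolute value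
  outside the sum over \<open>\<rho>\<close> and apply column orthogonality, which leaves a sum of nonnegative terms.

  Column orthogonality comes from \<open>\<Sum>\<^sub>\<rho> d\<^sub>\<rho> \<chi>\<^sub>\<rho>(g) = |G| [g = 1]\<close> by averaging \<open>\<rho>(x h x\<^sup>-\<^sup>1)\<close> over \<open>x\<close>, a scalar
  matrix by Schur's lemma. That identity in turn needs no complete reducibility: the character of the
  regular representation is a sum of irreducible characters already by block triangularization along
  invariant subspaces, and row orthogonality determines the multiplicities.
\<close>

section \<open>Schur's lemma\<close>

lemma index_mult_mat_sum:
  assumes "A \<in> carrier_mat n m" "B \<in> carrier_mat m k" "i < n" "j < k"
  shows "(A * B) $$ (i, j) = (\<Sum>l<m. A $$ (i, l) * B $$ (l, j))"
  using assms by (auto simp: scalar_prod_def atLeast0LessThan)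

lemma index_mult_mat_vec_sum:
  assumes "A \<in> carrier_mat n m" "v \<in> carrier_vec m" "i < n"
  shows "(A *\<^sub>v v) $ i = (\<Sum>l<m. A $$ (i, l) * v $ l)"
  using assms by (auto simp: scalar_prod_def atLeast0LessThan)

lemma minus_vec_eq_zeroD:
  fixes u v :: "'a :: group_add vec"
  assumes "u \<in> carrier_vec n" "v \<in> carrier_vec n" "u - v = 0\<^sub>v n"
  shows "u = v"
proof (rule eq_vecI)
  fix i assume "i < dim_vec v"
  moreover have "(u - v) $ i = 0\<^sub>v n $ i"
    by (simp only: assms(3))
  ultimately show "u $ i = v $ i"
    using assms(1,2) by simp
qed (use assms in auto)

lemma mult_mat_unit_vec:
  fixes A :: "'a :: comm_ring_1 mat"
  assumes "A \<in> carrier_mat n m" "j < m"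
  shows "A *\<^sub>v unit_vec m j = col A j"
  using assms by (intro eq_vecI) auto

lemma zero_mult_mat_vec:
  fixes v :: "'a :: comm_ring_1 vec"
  assumes "v \<in> carrier_vec m"
  shows "0\<^sub>m n m *\<^sub>v v = 0\<^sub>v n"
  using assms by (intro eq_vecI) auto

lemma smult_one_mult_vec:
  fixes v :: "'a :: comm_ring_1 vec"
  assumes "v \<in> carrier_vec n"
  shows "(c \<cdot>\<^sub>m 1\<^sub>m n) *\<^sub>v v = c \<cdot>\<^sub>v v"
  using assms by (intro eq_vecI) (auto simp: row_smult)

lemma eq_mat_mult_vecI:
  fixes A B :: "'a :: comm_ring_1 mat"
  assumes "A \<in> carrier_mat n m" "B \<in> carrier_mat n m"
    and "\<And>v. v \<in> carrier_vec m \<Longrightarrow> A *\<^sub>v v = B *\<^sub>v v"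
  shows "A = B"
proof (rule mat_col_eqI)
  fix j assume "j < dim_col B"
  then have "j < m" using assms by auto
  then show "col A j = col B j"
    using mult_mat_unit_vec[OF assms(1)] mult_mat_unit_vec[OF assms(2)]
      assms(3)[OF unit_vec_carrier] by metis
qed (use assms in auto)

lemma mat_trace_carrier: "A \<in> carrier_mat n n \<Longrightarrow> mat_trace A = (\<Sum>i<n. A $$ (i, i))"
  by (auto simp: mat_trace_def)

text \<open>Rectangular factors occur in \<open>schur_equivalence\<close>: when \<open>M * N\<close>
  and \<open>N * M\<close> are both identity matrices, comparing traces shows that their sizes
  agree.\<close>

lemma mat_trace_comm_rect:
  assumes "A \<in> carrier_mat n m" "B \<in> carrier_mat m n"
  shows "mat_trace (A * B) = mat_trace (B * A)"
proof -
  have "mat_trace (A * B) = (\<Sum>i<n. \<Sum>j<m. A $$ (i, j) * B $$ (j, i))"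
    using assms by (auto simp: mat_trace_def scalar_prod_def atLeast0LessThan intro!: sum.cong)
  also have "\<dots> = (\<Sum>j<m. \<Sum>i<n. B $$ (j, i) * A $$ (i, j))"
    by (subst sum.swap) (simp add: mult.commute)
  also have "\<dots> = mat_trace (B * A)"
    using assms by (auto simp: mat_trace_def scalar_prod_def atLeast0LessThan intro!: sum.cong)
  finally show ?thesis .
qed

lemma mat_trace_one [simp]: "mat_trace (1\<^sub>m n) = of_nat n"
  by (simp add: mat_trace_def)

lemma mat_trace_smult: "mat_trace (c \<cdot>\<^sub>m A) = c * mat_trace A" if "A \<in> carrier_mat n n"
  using that by (auto simp: mat_trace_def sum_distrib_left)

lemma subspace_module_vec_iff:
  "VectorSpace.subspace class_ring W (module_vec TYPE('a :: field) n) \<longleftrightarrow>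
    W \<subseteq> carrier_vec n \<and> 0\<^sub>v n \<in> W \<and> (\<forall>v\<in>W. \<forall>w\<in>W. v + w \<in> W) \<and> (\<forall>c. \<forall>v\<in>W. c \<cdot>\<^sub>v v \<in> W)"
  by (auto simp: VectorSpace.subspace_def LinearCombinations.submodule_def vec_vs vec_module
      module_vec_simps class_ring_simps)

section \<open>Representations in explicit matrix form\<close>

locale finite_group = group +
  assumes finite_carrier [simp, intro]: "finite (carrier G)"

text \<open>A homomorphism sends \<one> to an idempotent unit, and such a unit is the identity
  matrix. Conversely, multiplicativity and the value at \<one> make \<open>\<rho> (inv g)\<close> an
  inverse of \<open>\<rho> g\<close>, so all values are units.\<close>

lemma (in group) representation_iff:
  "representation G n \<rho> \<longleftrightarrow>
    (\<forall>g\<in>carrier G. \<rho> g \<in> carrier_mat n n) \<and>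
    (\<forall>g\<in>carrier G. \<forall>h\<in>carrier G. \<rho> (g \<otimes> h) = \<rho> g * \<rho> h) \<and> \<rho> \<one> = 1\<^sub>m n"
  (is "_ \<longleftrightarrow> ?R")
proof
  assume "representation G n \<rho>"
  then have U: "\<rho> g \<in> Units (ring_mat TYPE(complex) n ())"
    and hom: "h \<in> carrier G \<Longrightarrow> \<rho> (g \<otimes> h) = \<rho> g * \<rho> h" if "g \<in> carrier G" for g h
    using that by (auto simp: representation_def hom_def units_of_def ring_mat_simps)
  then have car: "\<rho> g \<in> carrier_mat n n" if "g \<in> carrier G" for g
    using that by (auto simp: Units_def ring_mat_simps)
  obtain Q where Q: "Q \<in> carrier_mat n n" "Q * \<rho> \<one> = 1\<^sub>m n"
    using U[of \<one>] by (auto simp: Units_def ring_mat_simps)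
  have "\<rho> \<one> = Q * \<rho> \<one> * \<rho> \<one>"
    using Q(2) car[of \<one>] by simp
  also have "\<dots> = Q * (\<rho> \<one> * \<rho> \<one>)"
    using Q(1) car[of \<one>] by (intro assoc_mult_mat) auto
  also have "\<rho> \<one> * \<rho> \<one> = \<rho> \<one>"
    using hom[of \<one> \<one>] by simp
  finally show ?R
    using Q(2) car hom by simp
next
  assume R: ?R
  have "\<rho> g * \<rho> (inv g) = 1\<^sub>m n" "\<rho> (inv g) * \<rho> g = 1\<^sub>m n" if "g \<in> carrier G" for g
    using R that by (metis inv_closed r_inv, metis inv_closed l_inv)
  with R show "representation G n \<rho>"
    by (auto simp: representation_def hom_def units_of_def ring_mat_simps Units_def
        intro!: bexI[where x = "\<rho> (inv _)"])
qed

context group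
begin

lemma representation_carrier: "representation G n \<rho> \<Longrightarrow> g \<in> carrier G \<Longrightarrow> \<rho> g \<in> carrier_mat n n"
  by (simp add: representation_iff)

lemma representation_mult:
  "representation G n \<rho> \<Longrightarrow> g \<in> carrier G \<Longrightarrow> h \<in> carrier G \<Longrightarrow> \<rho> (g \<otimes> h) = \<rho> g * \<rho> h"
  by (simp add: representation_iff)

lemma representation_one: "representation G n \<rho> \<Longrightarrow> \<rho> \<one> = 1\<^sub>m n"
  by (simp add: representation_iff)

lemma representation_inv:
  assumes "representation G n \<rho>" "g \<in> carrier G"
  shows "\<rho> g * \<rho> (inv g) = 1\<^sub>m n" "\<rho> (inv g) * \<rho> g = 1\<^sub>m n"
  using assms by (metis representation_mult representation_one inv_closed r_inv,
      metis representation_mult representation_one inv_closed l_inv)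

lemma irreducible_representation_invariant:
  assumes "irreducible_representation G n \<rho>" "W \<subseteq> carrier_vec n" "0\<^sub>v n \<in> W"
    and "\<And>v w. v \<in> W \<Longrightarrow> w \<in> W \<Longrightarrow> v + w \<in> W" "\<And>c v. v \<in> W \<Longrightarrow> c \<cdot>\<^sub>v v \<in> W"
    and "\<And>g w. g \<in> carrier G \<Longrightarrow> w \<in> W \<Longrightarrow> \<rho> g *\<^sub>v w \<in> W"
  shows "W = {0\<^sub>v n} \<or> W = carrier_vec n"
proof -
  have "VectorSpace.subspace class_ring W (module_vec TYPE(complex) n)"
    unfolding subspace_module_vec_iff using assms(2-5) by simp
  then show ?thesis
    using assms(1,6) unfolding irreducible_representation_def by simp
qed

text \<open>The kernel of \<open>M\<close> is invariant under \<open>\<sigma>\<close>, and it is not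
  the whole space because \<open>M\<close> is nonzero; irreducibility of \<open>\<sigma>\<close>
  leaves only the zero space.\<close>

lemma intertwiner_injective:
  assumes \<sigma>: "irreducible_representation G m \<sigma>" and \<tau>: "representation G n \<tau>"
    and M: "M \<in> carrier_mat n m" "M \<noteq> 0\<^sub>m n m"
    and intw: "\<And>g. g \<in> carrier G \<Longrightarrow> \<tau> g * M = M * \<sigma> g"
    and v: "v \<in> carrier_vec m" "M *\<^sub>v v = 0\<^sub>v n"
  shows "v = 0\<^sub>v m"
proof -
  let ?W = "{v \<in> carrier_vec m. M *\<^sub>v v = 0\<^sub>v n}"
  have \<sigma>': "representation G m \<sigma>"
    using \<sigma> by (simp add: irreducible_representation_def)
  have "?W = {0\<^sub>v m} \<or> ?W = carrier_vec m"
  proof (rule irreducible_representation_invariant[OF \<sigma>])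
    fix g w assume g: "g \<in> carrier G" and w: "w \<in> ?W"
    have "M *\<^sub>v (\<sigma> g *\<^sub>v w) = (M * \<sigma> g) *\<^sub>v w"
      using M w representation_carrier[OF \<sigma>' g] by (intro assoc_mult_mat_vec[symmetric]) auto
    also have "\<dots> = \<tau> g *\<^sub>v (M *\<^sub>v w)"
      using M w representation_carrier[OF \<tau> g] unfolding intw[OF g, symmetric]
      by (intro assoc_mult_mat_vec) auto
    also have "\<dots> = 0\<^sub>v n"
      using w representation_carrier[OF \<tau> g] by auto
    finally show "\<sigma> g *\<^sub>v w \<in> ?W"
      using w representation_carrier[OF \<sigma>' g] by auto
  qed (use M in \<open>auto simp: mult_add_distrib_mat_vec mult_mat_vec\<close>)
  moreover have "?W \<noteq> carrier_vec m"
  proof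
    assume W: "?W = carrier_vec m"
    have "M = 0\<^sub>m n m"
      by (rule eq_mat_mult_vecI[OF M(1)]) (use W in \<open>auto simp: zero_mult_mat_vec\<close>)
    with M show False by simp
  qed
  ultimately show ?thesis using v by blast
qed

text \<open>Dual to the injective case: the range of \<open>M\<close> is invariant under
  \<open>\<tau>\<close> and nonzero, so irreducibility of \<open>\<tau>\<close> makes it
  everything.\<close>

lemma intertwiner_surjective:
  assumes \<sigma>: "representation G m \<sigma>" and \<tau>: "irreducible_representation G n \<tau>"
    and M: "M \<in> carrier_mat n m" "M \<noteq> 0\<^sub>m n m"
    and intw: "\<And>g. g \<in> carrier G \<Longrightarrow> \<tau> g * M = M * \<sigma> g"
    and w: "w \<in> carrier_vec n"
  shows "\<exists>v\<in>carrier_vec m. M *\<^sub>v v = w"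
proof -
  let ?W = "(\<lambda>v. M *\<^sub>v v) ` carrier_vec m"
  have \<tau>': "representation G n \<tau>"
    using \<tau> by (simp add: irreducible_representation_def)
  have "?W = {0\<^sub>v n} \<or> ?W = carrier_vec n"
  proof (rule irreducible_representation_invariant[OF \<tau>])
    show "0\<^sub>v n \<in> ?W"
      using M by (intro image_eqI[of _ _ "0\<^sub>v m"]) auto
  next
    fix v w assume "v \<in> ?W" "w \<in> ?W"
    then obtain x y where "v = M *\<^sub>v x" "w = M *\<^sub>v y" "x \<in> carrier_vec m" "y \<in> carrier_vec m"
      by auto
    then show "v + w \<in> ?W"
      using M by (intro image_eqI[of _ _ "x + y"]) (auto simp: mult_add_distrib_mat_vec)
  next
    fix c v assume "v \<in> ?W"
    then obtain x where "v = M *\<^sub>v x" "x \<in> carrier_vec m"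
      by auto
    then show "c \<cdot>\<^sub>v v \<in> ?W"
      using M by (intro image_eqI[of _ _ "c \<cdot>\<^sub>v x"]) (auto simp: mult_mat_vec)
  next
    fix g w assume g: "g \<in> carrier G" and "w \<in> ?W"
    then obtain x where x: "w = M *\<^sub>v x" "x \<in> carrier_vec m"
      by auto
    have "\<tau> g *\<^sub>v w = (\<tau> g * M) *\<^sub>v x"
      using M x representation_carrier[OF \<tau>' g] by (auto intro!: assoc_mult_mat_vec[symmetric])
    also have "\<dots> = M *\<^sub>v (\<sigma> g *\<^sub>v x)"
      using M x representation_carrier[OF \<sigma> g] unfolding intw[OF g]
      by (intro assoc_mult_mat_vec) auto
    finally show "\<tau> g *\<^sub>v w \<in> ?W"
      using x representation_carrier[OF \<sigma> g] by auto
  qed (use M in auto)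
  moreover have "?W \<noteq> {0\<^sub>v n}"
  proof
    assume W: "?W = {0\<^sub>v n}"
    have "M = 0\<^sub>m n m"
      by (rule eq_mat_mult_vecI[OF M(1)]) (use W in \<open>auto simp: zero_mult_mat_vec\<close>)
    with M show False by simp
  qed
  ultimately show ?thesis using w by (metis (no_types, lifting) imageE)
qed

lemma schur_equivalence:
  assumes \<sigma>: "irreducible_representation G m \<sigma>" and \<tau>: "irreducible_representation G n \<tau>"
    and M: "M \<in> carrier_mat n m" "M \<noteq> 0\<^sub>m n m"
    and intw: "\<And>g. g \<in> carrier G \<Longrightarrow> \<tau> g * M = M * \<sigma> g"
  shows "(\<tau>, \<sigma>) \<in> rep_equivalence G"
proof -
  have \<sigma>': "representation G m \<sigma>" and \<tau>': "representation G n \<tau>"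
    using \<sigma> \<tau> by (simp_all add: irreducible_representation_def)
  have "\<exists>v\<in>carrier_vec m. M *\<^sub>v v = unit_vec n j" for j
    using unit_vec_carrier[of n j] intertwiner_surjective[OF \<sigma>' \<tau> M intw] by blast
  then obtain f where f: "\<And>j. f j \<in> carrier_vec m" "\<And>j. M *\<^sub>v f j = unit_vec n j"
    by metis
  \<comment> \<open>Column \<open>j\<close> of \<open>N\<close> is a chosen preimage of the
    \<open>j\<close>-th unit vector, so \<open>N\<close> is a right inverse of
    \<open>M\<close>.\<close>
  define N where "N = mat m n (\<lambda>(i, j). f j $ i)"
  have N: "N \<in> carrier_mat m n"
    by (simp add: N_def)
  have colN: "col N j = f j" if "j < n" for j
    using that f(1)[of j] by (intro eq_vecI) (auto simp: N_def)
  have MN: "M * N = 1\<^sub>m n"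
  proof (rule mat_col_eqI)
    fix j assume "j < dim_col (1\<^sub>m n :: complex mat)"
    then show "col (M * N) j = col (1\<^sub>m n) j"
      using col_mult2[OF M(1) N] colN f(2) by simp
  qed (use M N in auto)
  \<comment> \<open>Since \<open>M * N * M = M\<close>, the vector \<open>N * M * v - v\<close> lies
    in the kernel of \<open>M\<close>, which is trivial. Hence \<open>N\<close> is a left inverse
    too.\<close>
  have NM: "N * M = 1\<^sub>m m"
  proof (rule eq_mat_mult_vecI)
    fix v :: "complex vec" assume v: "v \<in> carrier_vec m"
    let ?u = "(N * M) *\<^sub>v v"
    have u: "?u \<in> carrier_vec m"
      using M(1) N v by (intro mult_mat_vec_carrier) auto
    have "M *\<^sub>v ?u = (M * (N * M)) *\<^sub>v v"
      using M N v by (intro assoc_mult_mat_vec[symmetric]) auto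
    also have "M * (N * M) = M"
      using M N by (subst assoc_mult_mat[symmetric]) (auto simp: MN)
    finally have "M *\<^sub>v (?u - v) = 0\<^sub>v n"
      using M v u by (auto simp: mult_minus_distrib_mat_vec)
    then have *: "?u - v = 0\<^sub>v m"
      using intertwiner_injective[OF \<sigma> \<tau>' M, of "?u - v"] intw u v by auto
    have "?u = v"
      by (rule minus_vec_eq_zeroD[OF u v *])
    then show "?u = 1\<^sub>m m *\<^sub>v v"
      using v by simp
  qed (use M N in auto)
  have "mat_trace (M * N) = mat_trace (N * M)"
    using M N by (intro mat_trace_comm_rect) auto
  then have [simp]: "m = n"
    by (simp add: MN NM)
  have "similar_mat_wit (\<tau> g) (\<sigma> g) M N" if g: "g \<in> carrier G" for g
  proof (rule similar_mat_witI)
    have "\<tau> g = \<tau> g * (M * N)"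
      using MN representation_carrier[OF \<tau>' g] by simp
    also have "\<dots> = M * \<sigma> g * N"
      using M N representation_carrier[OF \<tau>' g] by (subst assoc_mult_mat[symmetric]) (auto simp: intw[OF g])
    finally show "\<tau> g = M * \<sigma> g * N" .
  qed (use M N MN NM representation_carrier[OF \<tau>' g] representation_carrier[OF \<sigma>' g] in auto)
  with \<sigma> \<tau> show ?thesis
    by (auto simp: rep_equivalence_def irreducible_representations_def)
qed

text \<open>Over the complex numbers \<open>M\<close> has an eigenvalue \<open>c\<close>. Then
  \<open>M - c\<close> still commutes with the representation but kills an eigenvector, so it is not
  injective and must vanish.\<close>

lemma schur_scalar:
  assumes \<sigma>: "irreducible_representation G n \<sigma>" and M: "M \<in> carrier_mat n n"
    and comm: "\<And>g. g \<in> carrier G \<Longrightarrow> \<sigma> g * M = M * \<sigma> g"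
  shows "\<exists>c. M = c \<cdot>\<^sub>m 1\<^sub>m n"
proof -
  have \<sigma>': "representation G n \<sigma>" and n: "n > 0"
    using \<sigma> by (simp_all add: irreducible_representation_def)
  obtain c v where "eigenvector M v c"
    using spectrum_non_empty[OF M n] by (auto simp: spectrum_def eigenvalue_def)
  then have v: "v \<in> carrier_vec n" "v \<noteq> 0\<^sub>v n" "M *\<^sub>v v = c \<cdot>\<^sub>v v"
    using M by (auto simp: eigenvector_def)
  let ?N = "M - c \<cdot>\<^sub>m 1\<^sub>m n"
  have N: "?N \<in> carrier_mat n n"
    using M by auto
  have "?N = 0\<^sub>m n n"
  proof (rule ccontr)
    assume "?N \<noteq> 0\<^sub>m n n"
    moreover have "\<sigma> g * ?N = ?N * \<sigma> g" if g: "g \<in> carrier G" for g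
    proof -
      note \<sigma>g = representation_carrier[OF \<sigma>' g]
      have "\<sigma> g * (c \<cdot>\<^sub>m 1\<^sub>m n) = (c \<cdot>\<^sub>m 1\<^sub>m n) * \<sigma> g"
        using \<sigma>g by (simp add: mult_smult_distrib[OF \<sigma>g one_carrier_mat] mult_smult_assoc_mat[OF one_carrier_mat \<sigma>g])
      moreover have "\<sigma> g * ?N = \<sigma> g * M - \<sigma> g * (c \<cdot>\<^sub>m 1\<^sub>m n)"
        using M \<sigma>g by (intro mult_minus_distrib_mat) auto
      moreover have "?N * \<sigma> g = M * \<sigma> g - (c \<cdot>\<^sub>m 1\<^sub>m n) * \<sigma> g"
        using M \<sigma>g by (intro minus_mult_distrib_mat) auto
      ultimately show ?thesis using comm[OF g] by simp
    qed
    moreover have "?N *\<^sub>v v = 0\<^sub>v n"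
      using M v by (subst minus_mult_distrib_mat_vec[where nr = n and nc = n]) (auto simp: smult_one_mult_vec)
    ultimately show False
      using intertwiner_injective[OF \<sigma> \<sigma>' N] v by blast
  qed
  have "M = c \<cdot>\<^sub>m 1\<^sub>m n"
  proof (rule eq_matI)
    fix i j assume "i < dim_row (c \<cdot>\<^sub>m 1\<^sub>m n)" "j < dim_col (c \<cdot>\<^sub>m 1\<^sub>m n)"
    moreover from this have "?N $$ (i, j) = 0"
      unfolding \<open>?N = 0\<^sub>m n n\<close> by simp
    ultimately show "M $$ (i, j) = (c \<cdot>\<^sub>m 1\<^sub>m n) $$ (i, j)"
      using M by simp
  qed (use M in auto)
  then show ?thesis by blast
qed

end

section \<open>Orthogonality of irreducible characters\<close>

text \<open>The matrix unit usually called E_jk; placed between two matrices it isolates a product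
  of single entries.\<close>

definition elementary_mat :: "nat \<Rightarrow> nat \<Rightarrow> nat \<Rightarrow> nat \<Rightarrow> complex mat" where
  "elementary_mat n m j k = mat n m (\<lambda>(a, b). if a = j \<and> b = k then 1 else 0)"

lemma elementary_mat_carrier [simp]: "elementary_mat n m j k \<in> carrier_mat n m"
  by (simp add: elementary_mat_def)

lemma index_mult_elementary_mat_mult:
  assumes "A \<in> carrier_mat p n" "B \<in> carrier_mat m q" "i < p" "l < q" "j < n" "k < m"
  shows "(A * elementary_mat n m j k * B) $$ (i, l) = A $$ (i, j) * B $$ (k, l)"
proof -
  have *: "(A * elementary_mat n m j k) $$ (i, b) = (if b = k then A $$ (i, j) else 0)" if "b < m" for b
  proof -
    have "(A * elementary_mat n m j k) $$ (i, b)
        = (\<Sum>a<n. A $$ (i, a) * elementary_mat n m j k $$ (a, b))"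
      using assms that by (intro index_mult_mat_sum) auto
    also have "\<dots> = (\<Sum>a<n. if a = j then (if b = k then A $$ (i, a) else 0) else 0)"
      using that by (intro sum.cong) (auto simp: elementary_mat_def)
    finally show ?thesis using assms by simp
  qed
  have "(A * elementary_mat n m j k * B) $$ (i, l)
      = (\<Sum>b<m. (A * elementary_mat n m j k) $$ (i, b) * B $$ (b, l))"
    using assms by (intro index_mult_mat_sum) auto
  also have "\<dots> = (\<Sum>b<m. if b = k then A $$ (i, j) * B $$ (b, l) else 0)"
    by (intro sum.cong) (auto simp: *)
  finally show ?thesis using assms by simp
qed

lemma mat_trace_elementary_mat:
  assumes "j < n"
  shows "mat_trace (elementary_mat n n j k) = (if j = k then 1 else 0)"
proof -
  have "mat_trace (elementary_mat n n j k) = (\<Sum>a<n. if a = j then (if j = k then 1 else 0) else 0)"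
    by (auto simp: mat_trace_def elementary_mat_def intro!: sum.cong)
  then show ?thesis using assms by simp
qed

section \<open>Averaging over the group\<close>

context finite_group
begin

lemma sum_carrier_translate:
  assumes "x \<in> carrier G"
  shows "(\<Sum>g\<in>carrier G. f (x \<otimes> g)) = (\<Sum>g\<in>carrier G. f g)"
proof (rule sum.reindex_bij_betw)
  show "bij_betw ((\<otimes>) x) (carrier G) (carrier G)"
    using assms by (intro bij_betwI[where g = "(\<otimes>) (inv x)"]) (auto simp: m_assoc[symmetric])
qed

text \<open>The usual averaging of a matrix to an intertwiner from \<open>\<tau>\<close> to
  \<open>\<sigma>\<close>, without division by the group order. Working entrywise keeps all sums in
  the complex numbers.\<close>

definition twisted_sum :: "nat \<Rightarrow> nat \<Rightarrow> ('a \<Rightarrow> complex mat) \<Rightarrow> ('a \<Rightarrow> complex mat) \<Rightarrow> complex mat \<Rightarrow> complex mat"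
  where "twisted_sum n m \<sigma> \<tau> M =
    mat n m (\<lambda>(i, j). \<Sum>g\<in>carrier G. (\<sigma> g * M * \<tau> (inv g)) $$ (i, j))"

lemma twisted_sum_carrier [simp]: "twisted_sum n m \<sigma> \<tau> M \<in> carrier_mat n m"
  by (simp add: twisted_sum_def)

text \<open>Multiplication by \<open>\<sigma> x\<close> turns \<open>g\<close> into
  \<open>x \<otimes> g\<close> in the left factor; in the right factor,
  \<open>inv (x \<otimes> g) \<otimes> x = inv g\<close> splits off a \<open>\<tau> x\<close>.
  Reindexing by left translation finishes.\<close>

lemma twisted_sum_intertwines:
  assumes \<sigma>: "representation G n \<sigma>" and \<tau>: "representation G m \<tau>"
    and M: "M \<in> carrier_mat n m" and x: "x \<in> carrier G"
  shows "\<sigma> x * twisted_sum n m \<sigma> \<tau> M = twisted_sum n m \<sigma> \<tau> M * \<tau> x"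
proof (rule eq_matI)
  note car = representation_carrier[OF \<sigma>] representation_carrier[OF \<tau>]
  fix i j
  assume "i < dim_row (twisted_sum n m \<sigma> \<tau> M * \<tau> x)" "j < dim_col (twisted_sum n m \<sigma> \<tau> M * \<tau> x)"
  then have i: "i < n" and j: "j < m"
    using car(2)[OF x] by (auto simp: twisted_sum_def)
  have "(\<sigma> x * twisted_sum n m \<sigma> \<tau> M) $$ (i, j)
      = (\<Sum>k<n. \<sigma> x $$ (i, k) * twisted_sum n m \<sigma> \<tau> M $$ (k, j))"
    using i j car x by (intro index_mult_mat_sum) auto
  also have "\<dots> = (\<Sum>g\<in>carrier G. \<Sum>k<n. \<sigma> x $$ (i, k) * (\<sigma> g * M * \<tau> (inv g)) $$ (k, j))"
    using j by (subst sum.swap) (simp add: twisted_sum_def sum_distrib_left)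
  also have "\<dots> = (\<Sum>g\<in>carrier G. (\<sigma> x * (\<sigma> g * M * \<tau> (inv g))) $$ (i, j))"
    using i j car x M by (intro sum.cong refl index_mult_mat_sum[symmetric] mult_carrier_mat) auto
  also have "\<dots> = (\<Sum>g\<in>carrier G. (\<sigma> (x \<otimes> g) * M * \<tau> (inv (x \<otimes> g)) * \<tau> x) $$ (i, j))"
  proof (rule sum.cong)
    fix g assume g: "g \<in> carrier G"
    have "inv (x \<otimes> g) \<otimes> x = inv g"
      using x g by (simp add: inv_mult_group m_assoc)
    then have \<tau>g: "\<tau> (inv (x \<otimes> g)) * \<tau> x = \<tau> (inv g)"
      using representation_mult[OF \<tau>, of "inv (x \<otimes> g)" x] x g by simp
    have "\<sigma> (x \<otimes> g) * M * \<tau> (inv (x \<otimes> g)) * \<tau> x = \<sigma> (x \<otimes> g) * M * (\<tau> (inv (x \<otimes> g)) * \<tau> x)"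
      using x g M car by (intro assoc_mult_mat[of _ n m _ m _ m] mult_carrier_mat[of _ n n]) auto
    also have "\<dots> = \<sigma> x * \<sigma> g * M * \<tau> (inv g)"
      using representation_mult[OF \<sigma> x g] by (simp add: \<tau>g)
    also have "\<sigma> x * \<sigma> g * M = \<sigma> x * (\<sigma> g * M)"
      using x g M car by (intro assoc_mult_mat[of _ n n _ n _ m]) auto
    also have "\<sigma> x * (\<sigma> g * M) * \<tau> (inv g) = \<sigma> x * (\<sigma> g * M * \<tau> (inv g))"
      using x g M car by (intro assoc_mult_mat[of _ n n _ m _ m] mult_carrier_mat[of _ n n]) auto
    finally show "(\<sigma> x * (\<sigma> g * M * \<tau> (inv g))) $$ (i, j)
        = (\<sigma> (x \<otimes> g) * M * \<tau> (inv (x \<otimes> g)) * \<tau> x) $$ (i, j)"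
      by simp
  qed simp
  also have "\<dots> = (\<Sum>g\<in>carrier G. (\<sigma> g * M * \<tau> (inv g) * \<tau> x) $$ (i, j))"
    by (rule sum_carrier_translate[OF x])
  also have "\<dots> = (\<Sum>g\<in>carrier G. \<Sum>k<m. (\<sigma> g * M * \<tau> (inv g)) $$ (i, k) * \<tau> x $$ (k, j))"
    using i j car x M by (intro sum.cong refl index_mult_mat_sum mult_carrier_mat) auto
  also have "\<dots> = (\<Sum>k<m. twisted_sum n m \<sigma> \<tau> M $$ (i, k) * \<tau> x $$ (k, j))"
    using i by (subst sum.swap) (simp add: twisted_sum_def sum_distrib_right)
  also have "\<dots> = (twisted_sum n m \<sigma> \<tau> M * \<tau> x) $$ (i, j)"
    using i j car x by (intro index_mult_mat_sum[symmetric]) auto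
  finally show "(\<sigma> x * twisted_sum n m \<sigma> \<tau> M) $$ (i, j) = (twisted_sum n m \<sigma> \<tau> M * \<tau> x) $$ (i, j)" .
qed (use representation_carrier[OF \<sigma> x] representation_carrier[OF \<tau> x] in \<open>auto simp: twisted_sum_def\<close>)

text \<open>Schur's lemma makes the average a scalar matrix. The scalar is read off from the trace:
  each summand is similar to \<open>M\<close>, while the trace of \<open>c\<close> times the
  identity is \<open>c * n\<close>.\<close>

lemma twisted_sum_scalar:
  assumes \<sigma>: "irreducible_representation G n \<sigma>" and M: "M \<in> carrier_mat n n"
  shows "twisted_sum n n \<sigma> \<sigma> M = (of_nat (card (carrier G)) * mat_trace M / of_nat n) \<cdot>\<^sub>m 1\<^sub>m n"
proof -
  have \<sigma>': "representation G n \<sigma>" and n: "n > 0"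
    using \<sigma> by (simp_all add: irreducible_representation_def)
  obtain c where c: "twisted_sum n n \<sigma> \<sigma> M = c \<cdot>\<^sub>m 1\<^sub>m n"
    using schur_scalar[OF \<sigma> twisted_sum_carrier twisted_sum_intertwines[OF \<sigma>' \<sigma>' M]] by blast
  have "mat_trace (\<sigma> g * M * \<sigma> (inv g)) = mat_trace M" if g: "g \<in> carrier G" for g
  proof -
    have "\<sigma> g * M * \<sigma> (inv g) \<in> carrier_mat n n"
      using g M representation_carrier[OF \<sigma>'] by (intro mult_carrier_mat[of _ n n]) auto
    then have "similar_mat_wit (\<sigma> g * M * \<sigma> (inv g)) M (\<sigma> g) (\<sigma> (inv g))"
      using g M representation_inv[OF \<sigma>'] representation_carrier[OF \<sigma>']
      by (intro similar_mat_witI[of _ _ n]) auto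
    then show ?thesis by (rule mat_trace_similar)
  qed
  then have "(\<Sum>g\<in>carrier G. mat_trace (\<sigma> g * M * \<sigma> (inv g))) = of_nat (card (carrier G)) * mat_trace M"
    by simp
  moreover have "(\<Sum>g\<in>carrier G. mat_trace (\<sigma> g * M * \<sigma> (inv g)))
      = (\<Sum>g\<in>carrier G. \<Sum>i<n. (\<sigma> g * M * \<sigma> (inv g)) $$ (i, i))"
    using M representation_carrier[OF \<sigma>']
    by (intro sum.cong refl mat_trace_carrier mult_carrier_mat[of _ n n]) auto
  moreover have "\<dots> = mat_trace (twisted_sum n n \<sigma> \<sigma> M)"
    by (subst sum.swap) (simp add: mat_trace_def twisted_sum_def)
  ultimately have "c * of_nat n = of_nat (card (carrier G)) * mat_trace M"
    by (simp add: c mat_trace_smult[of _ n])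
  with n have "c = of_nat (card (carrier G)) * mat_trace M / of_nat n"
    by (simp add: eq_divide_eq)
  with c show ?thesis
    by simp
qed

text \<open>A product of a coefficient of \<open>\<sigma>\<close> and one of \<open>\<tau>\<close>
  is an entry of a matrix unit sandwiched between them. This puts character sums under the control
  of Schur's lemma.\<close>

lemma sum_index_mult_index:
  assumes "representation G n \<sigma>" "representation G m \<tau>" "i < n" "j < n" "k < m" "l < m"
  shows "(\<Sum>g\<in>carrier G. \<sigma> g $$ (i, j) * \<tau> (inv g) $$ (k, l))
    = twisted_sum n m \<sigma> \<tau> (elementary_mat n m j k) $$ (i, l)"
  using assms by (auto simp: twisted_sum_def index_mult_elementary_mat_mult[OF
      representation_carrier[OF assms(1)] representation_carrier[OF assms(2)]] intro!: sum.cong)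

lemma sum_mat_trace_mult_mat_trace:
  assumes \<sigma>: "representation G n \<sigma>" and \<tau>: "representation G m \<tau>"
  shows "(\<Sum>g\<in>carrier G. mat_trace (\<sigma> g) * mat_trace (\<tau> (inv g)))
    = (\<Sum>i<n. \<Sum>k<m. twisted_sum n m \<sigma> \<tau> (elementary_mat n m i k) $$ (i, k))"
proof -
  have "(\<Sum>g\<in>carrier G. mat_trace (\<sigma> g) * mat_trace (\<tau> (inv g)))
      = (\<Sum>g\<in>carrier G. \<Sum>i<n. \<Sum>k<m. \<sigma> g $$ (i, i) * \<tau> (inv g) $$ (k, k))"
    by (intro sum.cong refl)
      (simp add: mat_trace_carrier[OF representation_carrier[OF \<sigma>]]
        mat_trace_carrier[OF representation_carrier[OF \<tau>]] sum_product)
  also have "\<dots> = (\<Sum>i<n. \<Sum>k<m. \<Sum>g\<in>carrier G. \<sigma> g $$ (i, i) * \<tau> (inv g) $$ (k, k))"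
    by (subst sum.swap, intro sum.cong refl, rule sum.swap)
  also have "\<dots> = (\<Sum>i<n. \<Sum>k<m. twisted_sum n m \<sigma> \<tau> (elementary_mat n m i k) $$ (i, k))"
    by (intro sum.cong refl sum_index_mult_index[OF \<sigma> \<tau>]) auto
  finally show ?thesis .
qed

text \<open>A nonzero twisted sum would be a nonzero intertwiner and so an equivalence; hence all
  twisted sums vanish.\<close>

lemma character_orthogonal:
  assumes \<sigma>: "irreducible_representation G n \<sigma>" and \<tau>: "irreducible_representation G m \<tau>"
    and neq: "(\<sigma>, \<tau>) \<notin> rep_equivalence G"
  shows "(\<Sum>g\<in>carrier G. mat_trace (\<sigma> g) * mat_trace (\<tau> (inv g))) = 0"
proof -
  have \<sigma>': "representation G n \<sigma>" and \<tau>': "representation G m \<tau>"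
    using \<sigma> \<tau> by (simp_all add: irreducible_representation_def)
  have "twisted_sum n m \<sigma> \<tau> M = 0\<^sub>m n m" if M: "M \<in> carrier_mat n m" for M
    using schur_equivalence[OF \<tau> \<sigma> twisted_sum_carrier _ twisted_sum_intertwines[OF \<sigma>' \<tau>' M]] neq
    by blast
  then show ?thesis
    by (simp add: sum_mat_trace_mult_mat_trace[OF \<sigma>' \<tau>'])
qed

text \<open>The matrix unit at \<open>(i, k)\<close> averages to a scalar matrix whose
  \<open>(i, k)\<close> entry is nonzero only for \<open>i = k\<close>. The \<open>n\<close>
  diagonal terms contribute the group order divided by \<open>n\<close> each.\<close>

lemma character_normalized:
  assumes \<sigma>: "irreducible_representation G n \<sigma>"
  shows "(\<Sum>g\<in>carrier G. mat_trace (\<sigma> g) * mat_trace (\<sigma> (inv g))) = of_nat (card (carrier G))"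
proof -
  have \<sigma>': "representation G n \<sigma>" and n: "n > 0"
    using \<sigma> by (simp_all add: irreducible_representation_def)
  have "(\<Sum>g\<in>carrier G. mat_trace (\<sigma> g) * mat_trace (\<sigma> (inv g)))
      = (\<Sum>i<n. \<Sum>k<n. if k = i then of_nat (card (carrier G)) / of_nat n else 0)"
    unfolding sum_mat_trace_mult_mat_trace[OF \<sigma>' \<sigma>'] twisted_sum_scalar[OF \<sigma> elementary_mat_carrier]
    by (intro sum.cong refl) (auto simp: mat_trace_elementary_mat)
  also have "\<dots> = of_nat (card (carrier G))"
    using n by simp
  finally show ?thesis .
qed

text \<open>The conjugates of \<open>\<sigma> h\<close> sum to
  \<open>twisted_sum n n \<sigma> \<sigma> (\<sigma> h)\<close>, a scalar matrix; multiplying it by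
  \<open>\<sigma> k\<close> and taking traces separates the two characters.\<close>

lemma sum_character_conjugate_mult:
  assumes \<sigma>: "irreducible_representation G n \<sigma>" and h: "h \<in> carrier G" and k: "k \<in> carrier G"
  shows "of_nat n * (\<Sum>x\<in>carrier G. mat_trace (\<sigma> (x \<otimes> h \<otimes> inv x \<otimes> k)))
    = of_nat (card (carrier G)) * mat_trace (\<sigma> h) * mat_trace (\<sigma> k)"
proof -
  have \<sigma>': "representation G n \<sigma>" and n: "n > 0"
    using \<sigma> by (simp_all add: irreducible_representation_def)
  note car = representation_carrier[OF \<sigma>']
  have "(\<Sum>x\<in>carrier G. mat_trace (\<sigma> (x \<otimes> h \<otimes> inv x \<otimes> k)))
      = (\<Sum>x\<in>carrier G. \<Sum>i<n. \<Sum>j<n. (\<sigma> x * \<sigma> h * \<sigma> (inv x)) $$ (i, j) * \<sigma> k $$ (j, i))"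
  proof (intro sum.cong refl)
    fix x assume x: "x \<in> carrier G"
    have "\<sigma> (x \<otimes> h \<otimes> inv x \<otimes> k) = \<sigma> x * \<sigma> h * \<sigma> (inv x) * \<sigma> k"
      using x h k by (simp add: representation_mult[OF \<sigma>'])
    moreover have "\<sigma> x * \<sigma> h * \<sigma> (inv x) \<in> carrier_mat n n"
      using x h k car by (intro mult_carrier_mat) auto
    moreover from this have "\<sigma> x * \<sigma> h * \<sigma> (inv x) * \<sigma> k \<in> carrier_mat n n"
      using car[OF k] by simp
    ultimately show "mat_trace (\<sigma> (x \<otimes> h \<otimes> inv x \<otimes> k))
        = (\<Sum>i<n. \<Sum>j<n. (\<sigma> x * \<sigma> h * \<sigma> (inv x)) $$ (i, j) * \<sigma> k $$ (j, i))"
      using index_mult_mat_sum[OF _ car[OF k]]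
      by (simp add: mat_trace_carrier[of _ n] del: index_mult_mat)
  qed
  also have "\<dots> = (\<Sum>i<n. \<Sum>j<n. twisted_sum n n \<sigma> \<sigma> (\<sigma> h) $$ (i, j) * \<sigma> k $$ (j, i))"
    by (subst sum.swap, intro sum.cong refl, subst sum.swap)
      (auto simp: twisted_sum_def sum_distrib_right intro!: sum.cong)
  also have "\<dots> = (\<Sum>i<n. \<Sum>j<n. if j = i
      then of_nat (card (carrier G)) * mat_trace (\<sigma> h) / of_nat n * \<sigma> k $$ (i, i) else 0)"
    unfolding twisted_sum_scalar[OF \<sigma> car[OF h]] by (intro sum.cong refl) auto
  also have "\<dots> = of_nat (card (carrier G)) * mat_trace (\<sigma> h) / of_nat n * mat_trace (\<sigma> k)"
    using car[OF k] by (simp add: mat_trace_def sum_distrib_left)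
  finally show ?thesis
    using n by simp
qed

end

section \<open>Decomposition of characters\<close>

lemma invertible_matI:
  fixes P :: "'a :: field mat"
  assumes P: "P \<in> carrier_mat n n" and inj: "\<And>v. v \<in> carrier_vec n \<Longrightarrow> P *\<^sub>v v = 0\<^sub>v n \<Longrightarrow> v = 0\<^sub>v n"
  obtains Q where "Q \<in> carrier_mat n n" "P * Q = 1\<^sub>m n" "Q * P = 1\<^sub>m n"
proof -
  have "det P \<noteq> 0"
    using inj det_0_iff_vec_prod_zero_field[OF P] by blast
  from det_non_zero_imp_unit[OF P this, of "()"] show thesis
    using that by (auto simp: Units_def ring_mat_simps)
qed

text \<open>
  Replacing column \<open>k\<close> of a basis by \<open>w = P v\<close>, where \<open>v\<^sub>i \<noteq> 0\<close> for some \<open>i \<ge> k\<close>, and moving the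
  old column \<open>k\<close> to position \<open>i\<close>.
\<close>

lemma exchange_matrix:
  fixes v :: "'a :: field vec"
  assumes v: "v \<in> carrier_vec n" and "k \<le> i" "i < n" "v $ i \<noteq> 0"
  obtains E where "E \<in> carrier_mat n n"
    "\<And>x. x \<in> carrier_vec n \<Longrightarrow> E *\<^sub>v x = 0\<^sub>v n \<Longrightarrow> x = 0\<^sub>v n"
    "\<And>x. x \<in> carrier_vec n \<Longrightarrow> (\<And>j. k < j \<Longrightarrow> j < n \<Longrightarrow> x $ j = 0) \<Longrightarrow>
      E *\<^sub>v x = x $ k \<cdot>\<^sub>v v + vec n (\<lambda>j. if j < k then x $ j else 0)"
proof -
  \<comment> \<open>The entries are split into three tests on the column index \<open>b\<close>, so
    that each part of the sum over \<open>b\<close> collapses to one term.\<close>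
  define E where "E = mat n n (\<lambda>(a, b). (if b = k then v $ a else 0)
     + (if b = i then (if a = k \<and> i \<noteq> k then 1 else 0) else 0)
     + (if b = a then (if a \<noteq> k \<and> a \<noteq> i then 1 else 0) else 0))"
  have Ex: "(E *\<^sub>v x) $ a = x $ k * v $ a + (if a = k \<and> i \<noteq> k then x $ i else 0)
      + (if a \<noteq> k \<and> a \<noteq> i then x $ a else 0)" if x: "x \<in> carrier_vec n" and a: "a < n" for x a
  proof -
    have "(E *\<^sub>v x) $ a = (\<Sum>b<n. E $$ (a, b) * x $ b)"
      using x a by (intro index_mult_mat_vec_sum) (auto simp: E_def)
    also have "\<dots> = (\<Sum>b<n. (if b = k then x $ b * v $ a else 0)
        + (if b = i then (if a = k \<and> i \<noteq> k then x $ b else 0) else 0)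
        + (if b = a then (if a \<noteq> k \<and> a \<noteq> i then x $ b else 0) else 0))"
      using a by (intro sum.cong) (auto simp: E_def algebra_simps)
    also have "\<dots> = x $ k * v $ a + (if a = k \<and> i \<noteq> k then x $ i else 0)
        + (if a \<noteq> k \<and> a \<noteq> i then x $ a else 0)"
      using a assms by (simp only: sum.distrib sum.delta finite_lessThan) simp
    finally show ?thesis .
  qed
  show thesis
  proof
    show E: "E \<in> carrier_mat n n"
      by (simp add: E_def)
    show "x = 0\<^sub>v n" if x: "x \<in> carrier_vec n" and 0: "E *\<^sub>v x = 0\<^sub>v n" for x
    proof -
      have Ex0: "x $ k * v $ a + (if a = k \<and> i \<noteq> k then x $ i else 0)
          + (if a \<noteq> k \<and> a \<noteq> i then x $ a else 0) = 0" if "a < n" for a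
        using Ex[OF x that] that unfolding 0 by simp
      \<comment> \<open>Row \<open>i\<close> of the system reads \<open>x $ k * v $ i = 0\<close>.
        Row \<open>k\<close> then gives \<open>x $ i = 0\<close>, and each remaining row
        \<open>a\<close> gives \<open>x $ a = 0\<close>.\<close>
      have "x $ k = 0"
        using Ex0[of i] assms by (auto split: if_splits)
      moreover have "x $ i = 0"
        using Ex0[of k] assms \<open>x $ k = 0\<close> by (cases "i = k") auto
      ultimately have "x $ a = 0" if "a < n" for a
        using Ex0[OF that] by (auto split: if_splits)
      then show ?thesis
        using x by (intro eq_vecI) auto
    qed
    show "E *\<^sub>v x = x $ k \<cdot>\<^sub>v v + vec n (\<lambda>j. if j < k then x $ j else 0)"
      if x: "x \<in> carrier_vec n" and supp: "\<And>j. k < j \<Longrightarrow> j < n \<Longrightarrow> x $ j = 0" for x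
    proof (rule eq_vecI)
      fix a assume "a < dim_vec (x $ k \<cdot>\<^sub>v v + vec n (\<lambda>j. if j < k then x $ j else 0))"
      then have a: "a < n" by simp
      show "(E *\<^sub>v x) $ a = (x $ k \<cdot>\<^sub>v v + vec n (\<lambda>j. if j < k then x $ j else 0)) $ a"
        using assms supp[of i] supp[of a] v a unfolding Ex[OF x a] by auto
    qed (use E v in auto)
  qed
qed

text \<open>Choose an invertible \<open>P\<close> with as many leading columns in \<open>W\<close>
  as possible. If some \<open>w \<in> W\<close> had a nonzero coordinate beyond these, exchanging it
  into the basis would give one more such column. So \<open>W\<close> is exactly the span of the
  first \<open>k\<close> columns.\<close>

lemma adapted_basis:
  fixes W :: "'a :: field vec set"
  assumes W: "W \<subseteq> carrier_vec n" "0\<^sub>v n \<in> W"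
    and add: "\<And>v w. v \<in> W \<Longrightarrow> w \<in> W \<Longrightarrow> v + w \<in> W" and smult: "\<And>c v. v \<in> W \<Longrightarrow> c \<cdot>\<^sub>v v \<in> W"
  obtains k P Q where "k \<le> n" "P \<in> carrier_mat n n" "Q \<in> carrier_mat n n" "P * Q = 1\<^sub>m n" "Q * P = 1\<^sub>m n"
    "\<And>w. w \<in> carrier_vec n \<Longrightarrow> w \<in> W \<longleftrightarrow> (\<forall>j. k \<le> j \<longrightarrow> j < n \<longrightarrow> (Q *\<^sub>v w) $ j = 0)"
proof -
  \<comment> \<open>Invertibility is expressed by a trivial kernel, a condition that passes at once
    to the product \<open>P * E\<close> in the exchange step.\<close>
  define ok where "ok k P \<longleftrightarrow> P \<in> carrier_mat n n \<and>
      (\<forall>v\<in>carrier_vec n. P *\<^sub>v v = 0\<^sub>v n \<longrightarrow> v = 0\<^sub>v n) \<and>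
      (\<forall>x\<in>carrier_vec n. (\<forall>j. k \<le> j \<longrightarrow> j < n \<longrightarrow> x $ j = 0) \<longrightarrow> P *\<^sub>v x \<in> W)" for k P
  define good where "good k \<longleftrightarrow> k \<le> n \<and> (\<exists>P. ok k P)" for k
  have "ok 0 (1\<^sub>m n)"
  proof -
    have "1\<^sub>m n *\<^sub>v x \<in> W"
      if x: "x \<in> carrier_vec n" and "\<forall>j. 0 \<le> j \<longrightarrow> j < n \<longrightarrow> x $ j = 0" for x :: "'a vec"
    proof -
      have "x = 0\<^sub>v n"
        using that by (intro eq_vecI) auto
      then show ?thesis using W(2) by simp
    qed
    then show ?thesis
      unfolding ok_def by simp
  qed
  then have "good 0"
    by (auto simp: good_def)
  moreover have "good k \<Longrightarrow> k \<le> n" for k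
    by (simp add: good_def)
  ultimately obtain k where k: "good k" and max: "\<And>m. good m \<Longrightarrow> m \<le> k"
    using Nat.ex_has_greatest_nat[of good 0 n] by metis
  then obtain P where kn: "k \<le> n" and P: "P \<in> carrier_mat n n"
    and inj: "\<And>v. v \<in> carrier_vec n \<Longrightarrow> P *\<^sub>v v = 0\<^sub>v n \<Longrightarrow> v = 0\<^sub>v n"
    and PW: "\<And>x. x \<in> carrier_vec n \<Longrightarrow> (\<And>j. k \<le> j \<Longrightarrow> j < n \<Longrightarrow> x $ j = 0) \<Longrightarrow> P *\<^sub>v x \<in> W"
    unfolding good_def ok_def by blast
  obtain Q where Q: "Q \<in> carrier_mat n n" and PQ: "P * Q = 1\<^sub>m n" and QP: "Q * P = 1\<^sub>m n"
    using invertible_matI[OF P inj] by blast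
  have PQw: "P *\<^sub>v (Q *\<^sub>v w) = w" if "w \<in> carrier_vec n" for w
    using that assoc_mult_mat_vec[OF P Q that] by (simp add: PQ)
  have "w \<in> W \<longleftrightarrow> (\<forall>j. k \<le> j \<longrightarrow> j < n \<longrightarrow> (Q *\<^sub>v w) $ j = 0)" if w: "w \<in> carrier_vec n" for w
  proof
    assume "\<forall>j. k \<le> j \<longrightarrow> j < n \<longrightarrow> (Q *\<^sub>v w) $ j = 0"
    then have "P *\<^sub>v (Q *\<^sub>v w) \<in> W"
      using Q w by (intro PW) auto
    then show "w \<in> W"
      by (simp add: PQw[OF w])
  next
    assume wW: "w \<in> W"
    show "\<forall>j. k \<le> j \<longrightarrow> j < n \<longrightarrow> (Q *\<^sub>v w) $ j = 0"
    proof (rule ccontr)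
      let ?v = "Q *\<^sub>v w"
      assume "\<not> (\<forall>j. k \<le> j \<longrightarrow> j < n \<longrightarrow> ?v $ j = 0)"
      then obtain i where i: "k \<le> i" "i < n" "?v $ i \<noteq> 0"
        by auto
      have v: "?v \<in> carrier_vec n"
        using Q w by simp
      obtain E where E: "E \<in> carrier_mat n n"
        "\<And>x. x \<in> carrier_vec n \<Longrightarrow> E *\<^sub>v x = 0\<^sub>v n \<Longrightarrow> x = 0\<^sub>v n"
        "\<And>x. x \<in> carrier_vec n \<Longrightarrow> (\<And>j. k < j \<Longrightarrow> j < n \<Longrightarrow> x $ j = 0) \<Longrightarrow>
          E *\<^sub>v x = x $ k \<cdot>\<^sub>v ?v + vec n (\<lambda>j. if j < k then x $ j else 0)"
        using exchange_matrix[OF v i] by blast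
      have PE: "(P * E) *\<^sub>v x = P *\<^sub>v (E *\<^sub>v x)" if "x \<in> carrier_vec n" for x
        using assoc_mult_mat_vec[OF P E(1) that] .
      have "ok (Suc k) (P * E)"
        unfolding ok_def
      proof (intro conjI ballI impI)
        fix x :: "'a vec" assume x: "x \<in> carrier_vec n" and "(P * E) *\<^sub>v x = 0\<^sub>v n"
        then have "P *\<^sub>v (E *\<^sub>v x) = 0\<^sub>v n"
          by (simp add: PE)
        with E(1) x have "E *\<^sub>v x = 0\<^sub>v n"
          using inj[of "E *\<^sub>v x"] by simp
        with E(2) x show "x = 0\<^sub>v n" by blast
      next
        fix x :: "'a vec" assume x: "x \<in> carrier_vec n" and supp: "\<forall>j. Suc k \<le> j \<longrightarrow> j < n \<longrightarrow> x $ j = 0"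
        let ?x' = "vec n (\<lambda>j. if j < k then x $ j else 0)"
        have "(P * E) *\<^sub>v x = P *\<^sub>v (x $ k \<cdot>\<^sub>v ?v + ?x')"
          using supp by (simp add: PE x E(3))
        also have "\<dots> = P *\<^sub>v (x $ k \<cdot>\<^sub>v ?v) + P *\<^sub>v ?x'"
          using P v by (intro mult_add_distrib_mat_vec) auto
        also have "P *\<^sub>v (x $ k \<cdot>\<^sub>v ?v) = x $ k \<cdot>\<^sub>v w"
          using mult_mat_vec[OF P v] by (simp add: PQw[OF w])
        also have "x $ k \<cdot>\<^sub>v w + P *\<^sub>v ?x' \<in> W"
          by (intro add smult wW PW) auto
        finally show "(P * E) *\<^sub>v x \<in> W" .
      qed (rule mult_carrier_mat[OF P E(1)])
      then have "good (Suc k)"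
        using i by (auto simp: good_def)
      then show False
        using max[of "Suc k"] by simp
    qed
  qed
  with that kn P Q PQ QP show thesis by blast
qed

lemma sum_lessThan_split:
  fixes f :: "nat \<Rightarrow> 'a :: comm_monoid_add"
  assumes "k \<le> n"
  shows "(\<Sum>l<n. f l) = (\<Sum>l<k. f l) + (\<Sum>l<n - k. f (l + k))"
  using assms sum.atLeastLessThan_concat[of 0 k n f] sum.shift_bounds_nat_ivl[of f 0 k "n - k"]
  by (simp add: atLeast0LessThan)

section \<open>Block triangular form and constituents of a character\<close>

context group
begin

lemma representation_conjugate:
  assumes \<rho>: "representation G n \<rho>" and P: "P \<in> carrier_mat n n" and Q: "Q \<in> carrier_mat n n"
    and PQ: "P * Q = 1\<^sub>m n" and QP: "Q * P = 1\<^sub>m n"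
  shows "representation G n (\<lambda>g. Q * \<rho> g * P)"
    and "g \<in> carrier G \<Longrightarrow> mat_trace (Q * \<rho> g * P) = mat_trace (\<rho> g)"
proof -
  note car = representation_carrier[OF \<rho>]
  show "representation G n (\<lambda>g. Q * \<rho> g * P)"
    unfolding representation_iff
  proof (intro conjI ballI)
    fix g h assume g: "g \<in> carrier G" and h: "h \<in> carrier G"
    have "Q * \<rho> g * P * (Q * \<rho> h * P) = Q * \<rho> g * (P * (Q * \<rho> h * P))"
      using g h P Q car by (intro assoc_mult_mat[of _ n n _ n _ n] mult_carrier_mat[of _ n n]) auto
    also have "P * (Q * \<rho> h * P) = P * Q * (\<rho> h * P)"
      using assoc_mult_mat[OF Q car[OF h] P] assoc_mult_mat[OF P Q mult_carrier_mat[OF car[OF h] P]] by simp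
    also have "\<dots> = \<rho> h * P"
      using left_mult_one_mat[OF mult_carrier_mat[OF car[OF h] P]] by (simp add: PQ)
    also have "Q * \<rho> g * (\<rho> h * P) = Q * \<rho> g * \<rho> h * P"
      using g h P Q car by (intro assoc_mult_mat[of _ n n _ n _ n, symmetric] mult_carrier_mat[of _ n n]) auto
    also have "Q * \<rho> g * \<rho> h = Q * (\<rho> g * \<rho> h)"
      by (rule assoc_mult_mat[OF Q car[OF g] car[OF h]])
    finally show "Q * \<rho> (g \<otimes> h) * P = Q * \<rho> g * P * (Q * \<rho> h * P)"
      by (simp add: representation_mult[OF \<rho> g h])
  next
    fix g assume "g \<in> carrier G"
    then show "Q * \<rho> g * P \<in> carrier_mat n n"
      using P Q car by (intro mult_carrier_mat[of _ n n]) auto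
  next
    show "Q * \<rho> \<one> * P = 1\<^sub>m n"
      using Q by (simp add: representation_one[OF \<rho>] QP)
  qed
  assume g: "g \<in> carrier G"
  have "Q * \<rho> g * P \<in> carrier_mat n n"
    using g P Q car by (intro mult_carrier_mat[of _ n n]) auto
  then have "similar_mat_wit (Q * \<rho> g * P) (\<rho> g) Q P"
    using P Q PQ QP car[OF g] by (intro similar_mat_witI[of _ _ n]) auto
  then show "mat_trace (Q * \<rho> g * P) = mat_trace (\<rho> g)"
    by (rule mat_trace_similar)
qed

text \<open>Split the sum in the matrix product at \<open>k\<close>. For entries of either diagonal
  block, one of the two partial sums contains a factor from the zero lower left block.\<close>

lemma block_triangular_representation:
  assumes \<rho>: "representation G n \<rho>" and k: "k \<le> n"
    and zero: "\<And>g i j. g \<in> carrier G \<Longrightarrow> k \<le> i \<Longrightarrow> i < n \<Longrightarrow> j < k \<Longrightarrow> \<rho> g $$ (i, j) = 0"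
  defines "\<sigma> \<equiv> \<lambda>g. mat k k (\<lambda>(i, j). \<rho> g $$ (i, j))"
    and "\<tau> \<equiv> \<lambda>g. mat (n - k) (n - k) (\<lambda>(i, j). \<rho> g $$ (i + k, j + k))"
  shows "representation G k \<sigma>" "representation G (n - k) \<tau>"
    and "g \<in> carrier G \<Longrightarrow> mat_trace (\<rho> g) = mat_trace (\<sigma> g) + mat_trace (\<tau> g)"
proof -
  note car = representation_carrier[OF \<rho>]
  have mult: "\<rho> (g \<otimes> h) $$ (i, j) = (\<Sum>l<k. \<rho> g $$ (i, l) * \<rho> h $$ (l, j))
      + (\<Sum>l<n - k. \<rho> g $$ (i, l + k) * \<rho> h $$ (l + k, j))"
    if "g \<in> carrier G" "h \<in> carrier G" "i < n" "j < n" for g h i j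
    using that index_mult_mat_sum[OF car car, of g h i j]
    by (simp add: representation_mult[OF \<rho>] sum_lessThan_split[OF k] del: index_mult_mat)
  show "representation G k \<sigma>"
    unfolding representation_iff
  proof (intro conjI ballI)
    fix g h assume g: "g \<in> carrier G" and h: "h \<in> carrier G"
    show "\<sigma> (g \<otimes> h) = \<sigma> g * \<sigma> h"
    proof (rule eq_matI)
      fix i j assume "i < dim_row (\<sigma> g * \<sigma> h)" "j < dim_col (\<sigma> g * \<sigma> h)"
      then have ij: "i < k" "j < k"
        by (auto simp: \<sigma>_def)
      have "(\<sigma> g * \<sigma> h) $$ (i, j) = (\<Sum>l<k. \<sigma> g $$ (i, l) * \<sigma> h $$ (l, j))"
        using ij by (intro index_mult_mat_sum) (auto simp: \<sigma>_def)
      then show "\<sigma> (g \<otimes> h) $$ (i, j) = (\<sigma> g * \<sigma> h) $$ (i, j)"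
        using mult[OF g h, of i j] ij k zero[OF h] by (simp add: \<sigma>_def del: index_mult_mat)
    qed (auto simp: \<sigma>_def)
  qed (use k in \<open>auto simp: \<sigma>_def representation_one[OF \<rho>]\<close>)
  show "representation G (n - k) \<tau>"
    unfolding representation_iff
  proof (intro conjI ballI)
    fix g h assume g: "g \<in> carrier G" and h: "h \<in> carrier G"
    show "\<tau> (g \<otimes> h) = \<tau> g * \<tau> h"
    proof (rule eq_matI)
      fix i j assume "i < dim_row (\<tau> g * \<tau> h)" "j < dim_col (\<tau> g * \<tau> h)"
      then have ij: "i < n - k" "j < n - k"
        by (auto simp: \<tau>_def)
      have "(\<tau> g * \<tau> h) $$ (i, j) = (\<Sum>l<n - k. \<tau> g $$ (i, l) * \<tau> h $$ (l, j))"
        using ij by (intro index_mult_mat_sum) (auto simp: \<tau>_def)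
      then show "\<tau> (g \<otimes> h) $$ (i, j) = (\<tau> g * \<tau> h) $$ (i, j)"
        using mult[OF g h, of "i + k" "j + k"] ij k zero[OF g, of "i + k"]
        by (simp add: \<tau>_def less_diff_conv del: index_mult_mat)
    qed (auto simp: \<tau>_def)
  qed (use k in \<open>auto simp: \<tau>_def representation_one[OF \<rho>]\<close>)
  assume g: "g \<in> carrier G"
  show "mat_trace (\<rho> g) = mat_trace (\<sigma> g) + mat_trace (\<tau> g)"
    using mat_trace_carrier[OF car[OF g]] by (simp add: sum_lessThan_split[OF k] mat_trace_def \<sigma>_def \<tau>_def)
qed

text \<open>Induction on the degree: a proper nonzero invariant subspace gives two smaller diagonal
  blocks, whose traces add up. The constituents form a list so that multiplicities are kept.\<close>

lemma character_decomposition: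
  assumes "representation G n \<rho>"
  shows "\<exists>\<rho>s. set \<rho>s \<subseteq> irreducible_representations G \<and>
    (\<forall>g\<in>carrier G. mat_trace (\<rho> g) = (\<Sum>\<sigma>\<leftarrow>\<rho>s. mat_trace (\<sigma> g)))"
  using assms
proof (induction n arbitrary: \<rho> rule: less_induct)
  case (less n)
  note \<rho> = less.prems
  note car = representation_carrier[OF \<rho>]
  consider "n = 0" | "irreducible_representation G n \<rho>"
    | "n \<noteq> 0" "\<not> irreducible_representation G n \<rho>"
    by blast
  then show ?case
  proof cases
    \<comment> \<open>Degree 0 is excluded from irreducibility by definition and is represented by
      the empty list.\<close>
    case 1
    then show ?thesis
      using car by (intro exI[of _ "[]"]) (auto simp: mat_trace_carrier[of _ 0])
  next
    case 2
    then show ?thesis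
      by (intro exI[of _ "[\<rho>]"]) (auto simp: irreducible_representations_def)
  next
    case 3
    then obtain W where "VectorSpace.subspace class_ring W (module_vec TYPE(complex) n)"
      and inv: "\<And>g w. g \<in> carrier G \<Longrightarrow> w \<in> W \<Longrightarrow> \<rho> g *\<^sub>v w \<in> W"
      and W: "W \<noteq> {0\<^sub>v n}" "W \<noteq> carrier_vec n"
      using \<rho> unfolding irreducible_representation_def by blast
    then have sub: "W \<subseteq> carrier_vec n" "0\<^sub>v n \<in> W" "\<And>v w. v \<in> W \<Longrightarrow> w \<in> W \<Longrightarrow> v + w \<in> W"
      "\<And>c v. v \<in> W \<Longrightarrow> c \<cdot>\<^sub>v v \<in> W"
      by (auto simp: subspace_module_vec_iff)
    obtain k P Q where k: "k \<le> n" and P: "P \<in> carrier_mat n n" and Q: "Q \<in> carrier_mat n n"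
      and PQ: "P * Q = 1\<^sub>m n" and QP: "Q * P = 1\<^sub>m n"
      and W_iff: "\<And>w. w \<in> carrier_vec n \<Longrightarrow> w \<in> W \<longleftrightarrow> (\<forall>j. k \<le> j \<longrightarrow> j < n \<longrightarrow> (Q *\<^sub>v w) $ j = 0)"
      using adapted_basis[OF sub] by blast
    \<comment> \<open>The values \<open>k = n\<close> and \<open>k = 0\<close> would make
      \<open>W\<close> the whole space and the zero space; excluding both makes each diagonal block
      smaller than \<open>n\<close>.\<close>
    have "k \<noteq> n"
      using W_iff W(2) sub(1) by (metis linorder_not_less subsetI subset_antisym)
    have "k \<noteq> 0"
    proof
      assume "k = 0"
      have "w = 0\<^sub>v n" if "w \<in> W" for w
      proof -
        have w: "w \<in> carrier_vec n"
          using that sub(1) by blast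
        have "Q *\<^sub>v w = 0\<^sub>v n"
          using W_iff[OF w] that \<open>k = 0\<close> Q w by (intro eq_vecI) auto
        moreover have "P *\<^sub>v (Q *\<^sub>v w) = w"
          using assoc_mult_mat_vec[OF P Q w] w by (simp add: PQ)
        moreover have "P *\<^sub>v 0\<^sub>v n = 0\<^sub>v n"
          using P by (intro eq_vecI) auto
        ultimately show ?thesis
          by simp
      qed
      with sub(2) W(1) show False by blast
    qed
    let ?A = "\<lambda>g. Q * \<rho> g * P"
    have A: "representation G n ?A"
      by (rule representation_conjugate[OF \<rho> P Q PQ QP])
    \<comment> \<open>For \<open>j < k\<close> the \<open>j\<close>-th basis vector
      \<open>P *\<^sub>v ?e\<close> lies in \<open>W\<close>, and so does its image under
      \<open>\<rho> g\<close>. The coordinates of that image, which form column \<open>j\<close> of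
      \<open>?A g\<close>, vanish from \<open>k\<close> on.\<close>
    have zero: "?A g $$ (i, j) = 0" if g: "g \<in> carrier G" and i: "k \<le> i" "i < n" and j: "j < k" for g i j
    proof -
      let ?e = "unit_vec n j :: complex vec"
      let ?w = "\<rho> g *\<^sub>v (P *\<^sub>v ?e)"
      have Pe: "P *\<^sub>v ?e \<in> carrier_vec n"
        using P by simp
      have "Q *\<^sub>v (P *\<^sub>v ?e) = ?e"
        using assoc_mult_mat_vec[OF Q P, of ?e] by (simp add: QP)
      then have "P *\<^sub>v ?e \<in> W"
        unfolding W_iff[OF Pe] using j by simp
      then have "?w \<in> W"
        by (rule inv[OF g])
      moreover have w: "?w \<in> carrier_vec n"
        using car[OF g] Pe by simp
      ultimately have "(Q *\<^sub>v ?w) $ i = 0"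
        using W_iff[OF w] i by blast
      moreover have "Q *\<^sub>v ?w = ?A g *\<^sub>v ?e"
        using assoc_mult_mat_vec[OF Q car[OF g] Pe] assoc_mult_mat_vec[OF _ P, of "Q * \<rho> g" n ?e]
          mult_carrier_mat[OF Q car[OF g]] by simp
      moreover have "?A g *\<^sub>v ?e = col (?A g) j"
        using mult_mat_unit_vec[OF representation_carrier[OF A g]] j k by simp
      ultimately show ?thesis
        using Q i j by (simp add: col_def)
    qed
    note block = block_triangular_representation[OF A k zero]
    obtain \<rho>s where \<rho>s: "set \<rho>s \<subseteq> irreducible_representations G"
      "\<And>g. g \<in> carrier G \<Longrightarrow> mat_trace (mat k k (\<lambda>(i, j). ?A g $$ (i, j))) = (\<Sum>\<sigma>\<leftarrow>\<rho>s. mat_trace (\<sigma> g))"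
      using less.IH[OF _ block(1)] k \<open>k \<noteq> n\<close> by auto
    obtain \<tau>s where \<tau>s: "set \<tau>s \<subseteq> irreducible_representations G"
      "\<And>g. g \<in> carrier G \<Longrightarrow> mat_trace (mat (n - k) (n - k) (\<lambda>(i, j). ?A g $$ (i + k, j + k)))
        = (\<Sum>\<sigma>\<leftarrow>\<tau>s. mat_trace (\<sigma> g))"
      using less.IH[OF _ block(2)] k \<open>k \<noteq> 0\<close> by auto
    have "mat_trace (\<rho> g) = (\<Sum>\<sigma>\<leftarrow>\<rho>s @ \<tau>s. mat_trace (\<sigma> g))" if g: "g \<in> carrier G" for g
      using block(3)[OF _ _ _ _ g] representation_conjugate(2)[OF \<rho> P Q PQ QP g] \<rho>s(2)[OF g] \<tau>s(2)[OF g]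
      by simp
    with \<rho>s(1) \<tau>s(1) show ?thesis
      by (intro exI[of _ "\<rho>s @ \<tau>s"]) auto
  qed
qed

end

section \<open>Column orthogonality\<close>

lemma Irr_cases:
  assumes "C \<in> Irr G"
  obtains n \<rho> where "irreducible_representation G n \<rho>" "\<rho> \<in> C" "C = rep_equivalence G `` {\<rho>}"
proof -
  obtain \<rho> where \<rho>: "\<rho> \<in> irreducible_representations G" "C = rep_equivalence G `` {\<rho>}"
    using assms by (auto simp: Irr_def elim: quotientE)
  then have "\<rho> \<in> C"
    using equiv_class_self[OF equiv_rep_equivalence \<rho>(1)] by simp
  with \<rho> that show thesis
    by (auto simp: irreducible_representations_def)
qed

section \<open>The regular representation and its consequences\<close>

context finite_group
begin

text \<open>Left multiplication gives permutation matrices with respect to an enumeration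
  \<open>e\<close> of the group. Their trace counts fixed points, and translation by an element
  other than \<one> has none.\<close>

lemma ex_regular_representation:
  "\<exists>\<rho>. representation G (card (carrier G)) \<rho> \<and>
    (\<forall>g\<in>carrier G. mat_trace (\<rho> g) = (if g = \<one> then of_nat (card (carrier G)) else 0))"
proof -
  let ?N = "card (carrier G)"
  obtain e where e: "bij_betw e {..<?N} (carrier G)"
    using ex_bij_betw_nat_finite[OF finite_carrier] by (auto simp: atLeast0LessThan)
  have e_carrier [simp]: "e i \<in> carrier G" if "i < ?N" for i
    using e that by (auto simp: bij_betw_def)
  have e_eq: "e i = e j \<longleftrightarrow> i = j" if "i < ?N" "j < ?N" for i j
    using e that by (auto simp: bij_betw_def inj_on_def)
  define \<rho> :: "'a \<Rightarrow> complex mat" where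
    "\<rho> g = mat ?N ?N (\<lambda>(i, j). if e i = g \<otimes> e j then 1 else 0)" for g
  have "\<rho> (g \<otimes> h) = \<rho> g * \<rho> h" if g: "g \<in> carrier G" and h: "h \<in> carrier G" for g h
  proof (rule eq_matI)
    fix i j assume "i < dim_row (\<rho> g * \<rho> h)" "j < dim_col (\<rho> g * \<rho> h)"
    then have ij: "i < ?N" "j < ?N"
      by (auto simp: \<rho>_def)
    have "(\<rho> g * \<rho> h) $$ (i, j) = (\<Sum>l<?N. \<rho> g $$ (i, l) * \<rho> h $$ (l, j))"
      using ij by (intro index_mult_mat_sum) (auto simp: \<rho>_def)
    \<comment> \<open>Written as a function of \<open>e l\<close>, the summand can be summed over
      the group itself, where only \<open>y = h \<otimes> e j\<close> survives.\<close>
    also have "\<dots> = (\<Sum>l<?N. (\<lambda>y. if y = h \<otimes> e j then (if e i = g \<otimes> y then 1 else 0) else 0) (e l))"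
      using ij by (intro sum.cong) (auto simp: \<rho>_def)
    also have "\<dots> = (\<Sum>y\<in>carrier G. if y = h \<otimes> e j then (if e i = g \<otimes> y then 1 else 0) else 0)"
      by (rule sum.reindex_bij_betw[OF e])
    also have "\<dots> = \<rho> (g \<otimes> h) $$ (i, j)"
      using g h ij by (simp add: \<rho>_def m_assoc)
    finally show "\<rho> (g \<otimes> h) $$ (i, j) = (\<rho> g * \<rho> h) $$ (i, j)"
      by simp
  qed (auto simp: \<rho>_def)
  moreover have "\<rho> \<one> = 1\<^sub>m ?N"
    by (intro eq_matI) (auto simp: \<rho>_def e_eq)
  ultimately have "representation G ?N \<rho>"
    unfolding representation_iff by (auto simp: \<rho>_def)
  moreover have "mat_trace (\<rho> g) = (if g = \<one> then of_nat ?N else 0)" if g: "g \<in> carrier G" for g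
  proof -
    have "e i = g \<otimes> e i \<longleftrightarrow> g = \<one>" if "i < ?N" for i
      using g that r_cancel_one[of "e i" g] by auto
    then have "mat_trace (\<rho> g) = (\<Sum>i<?N. if g = \<one> then 1 else 0)"
      by (auto simp: mat_trace_def \<rho>_def intro!: sum.cong)
    then show ?thesis by simp
  qed
  ultimately show ?thesis by blast
qed

lemma irr_char_orthogonal:
  assumes C: "C \<in> Irr G" and D: "D \<in> Irr G"
  shows "(\<Sum>g\<in>carrier G. irr_char C g * irr_char D (inv g))
    = (if C = D then of_nat (card (carrier G)) else 0)"
proof -
  obtain n \<sigma> where \<sigma>: "irreducible_representation G n \<sigma>" "\<sigma> \<in> C"
    using C by (rule Irr_cases)
  obtain m \<tau> where \<tau>: "irreducible_representation G m \<tau>" "\<tau> \<in> D"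
    using D by (rule Irr_cases)
  \<comment> \<open>The representative of \<open>D\<close> stays free, so that for
    \<open>C = D\<close> the same \<open>\<sigma>\<close> can be taken on both sides.\<close>
  have eq: "(\<Sum>g\<in>carrier G. irr_char C g * irr_char D (inv g))
      = (\<Sum>g\<in>carrier G. mat_trace (\<sigma> g) * mat_trace (\<tau>' (inv g)))" if "\<tau>' \<in> D" for \<tau>'
    by (intro sum.cong refl) (simp add: irr_char_eq[OF C \<sigma>(2)] irr_char_eq[OF D that])
  show ?thesis
  proof (cases "C = D")
    case True
    then show ?thesis
      using eq[of \<sigma>] \<sigma> character_normalized[OF \<sigma>(1)] by simp
  next
    case False
    then have "(\<sigma>, \<tau>) \<notin> rep_equivalence G"
      using quotient_eq_iff[OF equiv_rep_equivalence, of C G D] C D \<sigma>(2) \<tau>(2) unfolding Irr_def by simp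
    then show ?thesis
      using eq[OF \<tau>(2)] character_orthogonal[OF \<sigma>(1) \<tau>(1)] False by simp
  qed
qed

lemma irr_dim_pos: "C \<in> Irr G \<Longrightarrow> 0 < irr_dim G C"
  by (metis Irr_cases irr_dim_eq irreducible_representation_def is_group)

lemma irr_char_one:
  assumes "C \<in> Irr G"
  shows "irr_char C \<one> = of_nat (irr_dim G C)"
proof -
  obtain n \<sigma> where \<sigma>: "irreducible_representation G n \<sigma>" "\<sigma> \<in> C"
    using assms by (rule Irr_cases)
  then have "representation G n \<sigma>"
    by (simp add: irreducible_representation_def)
  then show ?thesis
    using irr_char_eq[OF assms \<sigma>(2)] irr_dim_eq[OF is_group assms \<sigma>(2)] by (simp add: representation_one)
qed

text \<open>Decompose the regular character into a finite list. Row orthogonality shows that each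
  class \<open>D\<close> occurs in it \<open>irr_dim G D\<close> times. This number is positive, so
  the list meets every class and \<open>Irr G\<close> is finite; grouping the list by classes gives
  the identity. Finiteness comes first because a sum over an infinite set is 0 by default.\<close>

lemma finite_Irr: "finite (Irr G)"
  and sum_irr_dim_irr_char:
    "g \<in> carrier G \<Longrightarrow> (\<Sum>C\<in>Irr G. of_nat (irr_dim G C) * irr_char C g)
      = (if g = \<one> then of_nat (card (carrier G)) else 0)"
proof -
  let ?N = "of_nat (card (carrier G)) :: complex"
  have N: "?N \<noteq> 0"
    using finite_carrier one_closed by (auto simp: card_eq_0_iff)
  obtain \<rho> where \<rho>: "representation G (card (carrier G)) \<rho>"
    "\<And>g. g \<in> carrier G \<Longrightarrow> mat_trace (\<rho> g) = (if g = \<one> then ?N else 0)"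
    using ex_regular_representation by blast
  obtain \<rho>s where \<rho>s: "set \<rho>s \<subseteq> irreducible_representations G"
    "\<And>g. g \<in> carrier G \<Longrightarrow> mat_trace (\<rho> g) = (\<Sum>\<sigma>\<leftarrow>\<rho>s. mat_trace (\<sigma> g))"
    using character_decomposition[OF \<rho>(1)] by blast
  define c where "c i = rep_equivalence G `` {\<rho>s ! i}" for i
  let ?I = "{..<length \<rho>s}"
  have c: "c i \<in> Irr G" "\<rho>s ! i \<in> c i" if "i \<in> ?I" for i
  proof -
    have "\<rho>s ! i \<in> irreducible_representations G"
      using \<rho>s(1) that by auto
    then show "c i \<in> Irr G" "\<rho>s ! i \<in> c i"
      using equiv_class_self[OF equiv_rep_equivalence] by (auto simp: c_def Irr_def intro: quotientI)
  qed
  have reg: "(\<Sum>i\<in>?I. irr_char (c i) g) = (if g = \<one> then ?N else 0)" if g: "g \<in> carrier G" for g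
  proof -
    have "(\<Sum>i\<in>?I. irr_char (c i) g) = (\<Sum>i\<in>?I. mat_trace ((\<rho>s ! i) g))"
      using g by (intro sum.cong refl irr_char_eq[OF c(1) c(2)]) auto
    also have "\<dots> = mat_trace (\<rho> g)"
      using \<rho>s(2)[OF g] by (simp add: sum_list_sum_nth atLeast0LessThan)
    finally show ?thesis
      by (simp add: \<rho>(2)[OF g])
  qed
  have mult: "of_nat (card {i\<in>?I. c i = D}) = (of_nat (irr_dim G D) :: complex)" if D: "D \<in> Irr G" for D
  proof -
    \<comment> \<open>The regular character is concentrated at \<one>, so pairing it with
      \<open>D\<close> leaves the degree of \<open>D\<close>; expanding it into constituents counts
      those in \<open>D\<close>.\<close>
    have "?N * of_nat (irr_dim G D) = (\<Sum>g\<in>carrier G. if g = \<one> then ?N * irr_char D (inv g) else 0)"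
      by (simp add: irr_char_one[OF D])
    also have "\<dots> = (\<Sum>g\<in>carrier G. (\<Sum>i\<in>?I. irr_char (c i) g) * irr_char D (inv g))"
      by (intro sum.cong refl) (simp add: reg)
    also have "\<dots> = (\<Sum>i\<in>?I. \<Sum>g\<in>carrier G. irr_char (c i) g * irr_char D (inv g))"
      by (subst sum.swap) (simp add: sum_distrib_right)
    also have "\<dots> = (\<Sum>i\<in>?I. if c i = D then ?N else 0)"
      by (intro sum.cong refl irr_char_orthogonal c D)
    also have "\<dots> = ?N * of_nat (card {i\<in>?I. c i = D})"
      by (simp add: sum.If_cases Int_def)
    finally show ?thesis
      using N by simp
  qed
  have "Irr G \<subseteq> c ` ?I"
  proof
    fix D assume D: "D \<in> Irr G"
    then have "card {i\<in>?I. c i = D} \<noteq> 0"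
      using mult[OF D] irr_dim_pos[OF D] by simp
    then show "D \<in> c ` ?I"
      by (auto simp: card_eq_0_iff)
  qed
  then show fin: "finite (Irr G)"
    by (rule finite_subset) simp
  assume g: "g \<in> carrier G"
  have "(\<Sum>C\<in>Irr G. of_nat (irr_dim G C) * irr_char C g)
      = (\<Sum>C\<in>Irr G. \<Sum>i\<in>{i\<in>?I. c i = C}. irr_char (c i) g)"
    by (intro sum.cong refl) (simp add: mult[symmetric])
  also have "\<dots> = (\<Sum>i\<in>?I. irr_char (c i) g)"
    using c(1) by (intro sum.group fin) auto
  finally show "(\<Sum>C\<in>Irr G. of_nat (irr_dim G C) * irr_char C g) = (if g = \<one> then ?N else 0)"
    by (simp add: reg[OF g])
qed

text \<open>After multiplication by the group order, the product of characters becomes a sum over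
  \<open>x\<close> of the weighted character at
  \<open>x \<otimes> h \<otimes> inv x \<otimes> k\<close>. Exchanging the sums, only those
  \<open>x\<close> count for which this element is \<one>.\<close>

lemma sum_irr_char_mult:
  assumes h: "h \<in> carrier G" and k: "k \<in> carrier G"
  shows "(\<Sum>C\<in>Irr G. irr_char C h * irr_char C k)
    = of_nat (card {x \<in> carrier G. x \<otimes> h \<otimes> inv x = inv k})"
proof -
  let ?N = "of_nat (card (carrier G)) :: complex"
  have N: "?N \<noteq> 0"
    using finite_carrier one_closed by (auto simp: card_eq_0_iff)
  have "?N * (\<Sum>C\<in>Irr G. irr_char C h * irr_char C k)
      = (\<Sum>C\<in>Irr G. \<Sum>x\<in>carrier G. of_nat (irr_dim G C) * irr_char C (x \<otimes> h \<otimes> inv x \<otimes> k))"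
    unfolding sum_distrib_left
  proof (rule sum.cong)
    fix C assume C: "C \<in> Irr G"
    obtain n \<sigma> where \<sigma>: "irreducible_representation G n \<sigma>" "\<sigma> \<in> C"
      using C by (rule Irr_cases)
    then have \<sigma>': "representation G n \<sigma>"
      by (simp add: irreducible_representation_def)
    have "(\<Sum>x\<in>carrier G. irr_char C (x \<otimes> h \<otimes> inv x \<otimes> k))
        = (\<Sum>x\<in>carrier G. mat_trace (\<sigma> (x \<otimes> h \<otimes> inv x \<otimes> k)))"
      using h k by (intro sum.cong refl irr_char_eq[OF C \<sigma>(2)]) auto
    then show "?N * (irr_char C h * irr_char C k)
        = (\<Sum>x\<in>carrier G. of_nat (irr_dim G C) * irr_char C (x \<otimes> h \<otimes> inv x \<otimes> k))"
      using sum_character_conjugate_mult[OF \<sigma>(1) h k]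
      by (simp add: irr_char_eq[OF C \<sigma>(2)] h k irr_dim_eq[OF is_group C \<sigma>(2) \<sigma>'] mult.assoc
          flip: sum_distrib_left)
  qed simp
  also have "\<dots> = (\<Sum>x\<in>carrier G. \<Sum>C\<in>Irr G. of_nat (irr_dim G C) * irr_char C (x \<otimes> h \<otimes> inv x \<otimes> k))"
    by (rule sum.swap)
  also have "\<dots> = (\<Sum>x\<in>carrier G. if x \<otimes> h \<otimes> inv x = inv k then ?N else 0)"
  proof (rule sum.cong)
    fix x assume x: "x \<in> carrier G"
    have "x \<otimes> h \<otimes> inv x \<otimes> k = \<one> \<longleftrightarrow> x \<otimes> h \<otimes> inv x = inv k"
      using x h k by (metis inv_equality inv_inv inv_closed l_inv m_closed)
    then show "(\<Sum>C\<in>Irr G. of_nat (irr_dim G C) * irr_char C (x \<otimes> h \<otimes> inv x \<otimes> k))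
        = (if x \<otimes> h \<otimes> inv x = inv k then ?N else 0)"
      using x h k by (subst sum_irr_dim_irr_char) auto
  qed simp
  also have "\<dots> = ?N * of_nat (card {x \<in> carrier G. x \<otimes> h \<otimes> inv x = inv k})"
    by (simp add: sum.If_cases Int_def)
  finally show ?thesis
    using N by simp
qed

end

section \<open>Values of characters\<close>

text \<open>On or below the diagonal only the middle index \<open>l = i\<close> can contribute:
  \<open>A\<close> kills \<open>l < i\<close> and \<open>B\<close> kills
  \<open>l > i\<close>.\<close>

lemma upper_triangular_mult:
  fixes A B :: "'a :: semiring_1 mat"
  assumes A: "A \<in> carrier_mat n n" "upper_triangular A" and B: "B \<in> carrier_mat n n" "upper_triangular B"
  shows "upper_triangular (A * B)" and "i < n \<Longrightarrow> (A * B) $$ (i, i) = A $$ (i, i) * B $$ (i, i)"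
proof -
  have entry: "(A * B) $$ (i, j) = (\<Sum>l<n. if l = i then A $$ (i, i) * B $$ (i, j) else 0)"
    if ij: "j \<le> i" "i < n" for i j
  proof -
    have "A $$ (i, l) * B $$ (l, j) = (if l = i then A $$ (i, i) * B $$ (i, j) else 0)" if "l < n" for l
      using that ij A B upper_triangularD[OF A(2), of l i] upper_triangularD[OF B(2), of j l]
      by (cases l i rule: linorder_cases) auto
    moreover have "(A * B) $$ (i, j) = (\<Sum>l<n. A $$ (i, l) * B $$ (l, j))"
      using that by (intro index_mult_mat_sum[OF A(1) B(1)]) auto
    ultimately show ?thesis
      by (simp cong: sum.cong_simp del: index_mult_mat)
  qed
  show "upper_triangular (A * B)"
  proof (rule upper_triangularI)
    fix i j assume "j < i" "i < dim_row (A * B)"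
    then show "(A * B) $$ (i, j) = 0"
      using entry[of j i] A B upper_triangularD[OF B(2), of j i] by (simp del: index_mult_mat(1))
  qed
  show "(A * B) $$ (i, i) = A $$ (i, i) * B $$ (i, i)" if "i < n"
    using entry[of i i] that by simp
qed

lemma upper_triangular_pow:
  fixes A :: "'a :: semiring_1 mat"
  assumes A: "A \<in> carrier_mat n n" "upper_triangular A"
  shows "upper_triangular (A ^\<^sub>m k)" and "i < n \<Longrightarrow> (A ^\<^sub>m k) $$ (i, i) = A $$ (i, i) ^ k"
proof -
  have "upper_triangular (A ^\<^sub>m k) \<and> (\<forall>i<n. (A ^\<^sub>m k) $$ (i, i) = A $$ (i, i) ^ k)"
  proof (induction k)
    case 0
    then show ?case using A by simp
  next
    case (Suc k)
    have "A ^\<^sub>m k \<in> carrier_mat n n"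
      using A by (intro pow_carrier_mat)
    from upper_triangular_mult[OF this _ A] Suc show ?case
      by (simp add: power_commutes del: index_mult_mat)
  qed
  then show "upper_triangular (A ^\<^sub>m k)" and "i < n \<Longrightarrow> (A ^\<^sub>m k) $$ (i, i) = A $$ (i, i) ^ k"
    by auto
qed

text \<open>The \<open>b i\<close> are the diagonal entries of a Schur triangularization, that is,
  the eigenvalues with multiplicity. One choice serves all powers at once, since powers of a
  triangular matrix act entrywise on its diagonal.\<close>

lemma mat_trace_pow_eq_sum_power:
  assumes A: "A \<in> carrier_mat n n"
  obtains b where "\<And>k. mat_trace (A ^\<^sub>m k) = (\<Sum>i<n. b i ^ k)"
    and "\<And>k i. A ^\<^sub>m k = 1\<^sub>m n \<Longrightarrow> i < n \<Longrightarrow> b i ^ k = 1"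
proof -
  obtain es where "char_poly A = (\<Prod>a\<leftarrow>es. [:- a, 1:])"
    using char_poly_factorized[OF A] by blast
  moreover obtain B P Q where "schur_decomposition A es = (B, P, Q)"
    by (cases "schur_decomposition A es") auto
  ultimately have sim: "similar_mat_wit A B P Q" and tri: "upper_triangular B"
    using schur_decomposition[OF A] by blast+
  note wit = similar_mat_witD2[OF A sim]
  have B: "B \<in> carrier_mat n n"
    using wit by blast
  have tr: "mat_trace (A ^\<^sub>m k) = (\<Sum>i<n. B $$ (i, i) ^ k)" for k
    using mat_trace_similar[OF similar_mat_wit_pow[OF sim]]
      mat_trace_carrier[OF pow_carrier_mat[OF B]] upper_triangular_pow(2)[OF B tri]
    by simp
  have "B $$ (i, i) ^ k = 1" if "A ^\<^sub>m k = 1\<^sub>m n" "i < n" for k i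
  proof -
    have "B ^\<^sub>m k = Q * A ^\<^sub>m k * P"
      using similar_mat_wit_pow_id[OF similar_mat_wit_sym[OF sim]] .
    also have "\<dots> = 1\<^sub>m n"
      using wit unfolding that(1) by simp
    finally show ?thesis
      using upper_triangular_pow(2)[OF B tri that(2), of k] that(2) by simp
  qed
  then show thesis
    by (rule that[of "\<lambda>i. B $$ (i, i)", OF tr])
qed

context finite_group
begin

lemma representation_pow:
  assumes "representation G n \<rho>" "g \<in> carrier G"
  shows "\<rho> (g [^] k) = \<rho> g ^\<^sub>m k"
  using assms representation_carrier[OF assms]
  by (induction k) (auto simp: representation_one representation_mult)

text \<open>The eigenvalues of \<open>\<rho> g\<close> are roots of unity because the group order
  annihilates \<open>g\<close>. They have modulus 1, which gives the bound, and their inverses are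
  their conjugates.\<close>

lemma mat_trace_representation:
  assumes \<rho>: "representation G n \<rho>" and g: "g \<in> carrier G"
  shows "mat_trace (\<rho> (inv g)) = cnj (mat_trace (\<rho> g))" and "cmod (mat_trace (\<rho> g)) \<le> n"
proof -
  let ?N = "card (carrier G)"
  have N: "?N > 0"
    using one_closed by (auto simp: card_gt_0_iff)
  have gN: "g [^] ?N = \<one>"
    using pow_order_eq_1[OF g] by (simp add: Coset.order_def)
  obtain b where tr: "\<And>k. mat_trace (\<rho> g ^\<^sub>m k) = (\<Sum>i<n. b i ^ k)"
    and root: "\<And>k i. \<rho> g ^\<^sub>m k = 1\<^sub>m n \<Longrightarrow> i < n \<Longrightarrow> b i ^ k = 1"
    using mat_trace_pow_eq_sum_power[OF representation_carrier[OF \<rho> g]] by blast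
  have bN: "b i ^ ?N = 1" if "i < n" for i
    using root[OF _ that] representation_pow[OF \<rho> g, of ?N] by (simp add: gN representation_one[OF \<rho>])
  have norm_b: "cmod (b i) = 1" if "i < n" for i
  proof (rule power_eq_imp_eq_base)
    show "cmod (b i) ^ ?N = 1 ^ ?N"
      using bN[OF that] by (simp flip: norm_power)
  qed (use N in auto)
  have trg: "mat_trace (\<rho> g) = (\<Sum>i<n. b i)"
    using tr[of 1] representation_carrier[OF \<rho> g] by simp
  have "g [^] (?N - 1) \<otimes> g = \<one>"
    using gN N nat_pow_Suc[of g "?N - 1"] by simp
  \<comment> \<open>As a power of \<open>g\<close>, the inverse has a trace given by the same
    eigenvalues \<open>b i\<close>.\<close>
  then have "inv g = g [^] (?N - 1)"
    using g by (intro inv_equality) auto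
  then have "mat_trace (\<rho> (inv g)) = (\<Sum>i<n. b i ^ (?N - 1))"
    using representation_pow[OF \<rho> g] tr by simp
  also have "\<dots> = (\<Sum>i<n. cnj (b i))"
  proof (rule sum.cong)
    fix i assume "i \<in> {..<n}"
    then have i: "i < n" by simp
    have "b i * b i ^ (?N - 1) = 1"
      using bN[OF i] N by (metis power_eq_if not_gr_zero)
    moreover have "b i * cnj (b i) = 1"
      using norm_b[OF i] by (simp add: complex_norm_square[symmetric])
    ultimately show "b i ^ (?N - 1) = cnj (b i)"
      by (metis mult_cancel_left mult_zero_left zero_neq_one)
  qed simp
  finally show "mat_trace (\<rho> (inv g)) = cnj (mat_trace (\<rho> g))"
    by (simp add: trg)
  have "cmod (\<Sum>i<n. b i) \<le> (\<Sum>i<n. cmod (b i))"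
    by (rule norm_sum)
  also have "\<dots> = n"
    by (simp add: norm_b)
  finally show "cmod (mat_trace (\<rho> g)) \<le> n"
    by (simp add: trg)
qed

lemma irr_char_inv:
  assumes C: "C \<in> Irr G" and g: "g \<in> carrier G"
  shows "irr_char C (inv g) = cnj (irr_char C g)"
proof -
  obtain n \<sigma> where \<sigma>: "irreducible_representation G n \<sigma>" "\<sigma> \<in> C"
    using C by (rule Irr_cases)
  then show ?thesis
    using mat_trace_representation(1)[of n \<sigma> g] g irr_char_eq[OF C \<sigma>(2)]
    by (simp add: irreducible_representation_def)
qed

lemma norm_irr_char_le:
  assumes C: "C \<in> Irr G" and g: "g \<in> carrier G"
  shows "cmod (irr_char C g) \<le> irr_dim G C"
proof -
  obtain n \<sigma> where \<sigma>: "irreducible_representation G n \<sigma>" "\<sigma> \<in> C"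
    using C by (rule Irr_cases)
  then show ?thesis
    using mat_trace_representation(2)[of n \<sigma> g] g irr_char_eq[OF C \<sigma>(2)] irr_dim_eq[OF is_group C \<sigma>(2), of n]
    by (simp add: irreducible_representation_def)
qed

end

section \<open>Bounds on the distinguishability measure\<close>

context finite_group
begin

text \<open>Orbit-stabilizer: the fibres of \<open>x \<mapsto> x \<otimes> h \<otimes> inv x\<close>
  over the class are left translates of the centralizer \<open>?Z\<close>, so all have its
  size.\<close>

lemma card_conj_class:
  assumes h: "h \<in> carrier G"
  shows "card (conj_class G h) * card {x \<in> carrier G. x \<otimes> h \<otimes> inv x = h} = card (carrier G)"
proof -
  let ?f = "\<lambda>x. x \<otimes> h \<otimes> inv x"
  let ?Z = "{x \<in> carrier G. ?f x = h}"
  have conj: "conj_class G h = ?f ` carrier G"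
    by (auto simp: conj_class_def)
  have "card {x \<in> carrier G. ?f x = y} = card ?Z" if y: "y \<in> conj_class G h" for y
  proof -
    obtain a where a: "a \<in> carrier G" "y = ?f a"
      using y unfolding conj by blast
    have "?f (a \<otimes> x) = a \<otimes> ?f x \<otimes> inv a" if "x \<in> carrier G" for x
      using a h that by (simp add: inv_mult_group m_assoc)
    moreover have "a \<otimes> z \<otimes> inv a = y \<longleftrightarrow> z = h" if "z \<in> carrier G" for z
      using a h that by simp
    ultimately have eq: "?f (a \<otimes> x) = y \<longleftrightarrow> ?f x = h" if "x \<in> carrier G" for x
      using that h by simp
    have "bij_betw ((\<otimes>) a) ?Z {x \<in> carrier G. ?f x = y}"
    proof (rule bij_betwI[where g = "(\<otimes>) (inv a)"])
      show "(\<otimes>) (inv a) \<in> {x \<in> carrier G. ?f x = y} \<rightarrow> ?Z"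
      proof
        fix x assume x: "x \<in> {x \<in> carrier G. ?f x = y}"
        then have "a \<otimes> (inv a \<otimes> x) = x"
          using a by (simp add: m_assoc[symmetric])
        with x a eq[of "inv a \<otimes> x"] show "inv a \<otimes> x \<in> ?Z"
          by simp
      qed
    qed (use a eq in \<open>auto simp: m_assoc[symmetric]\<close>)
    then show ?thesis
      by (simp add: bij_betw_same_card)
  qed
  then have "(\<Sum>y\<in>conj_class G h. card {x \<in> carrier G. ?f x = y}) = card (conj_class G h) * card ?Z"
    by simp
  moreover have "(\<Sum>y\<in>conj_class G h. card {x \<in> carrier G. ?f x = y}) = card (carrier G)"
    using sum.group[of "carrier G" "conj_class G h" ?f "\<lambda>_. 1 :: nat"] by (simp add: conj)
  ultimately show ?thesis by simp
qed

lemma card_conj_class_pos: "h \<in> carrier G \<Longrightarrow> 0 < card (conj_class G h)"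
  using card_conj_class[of h] one_closed by (cases "card (conj_class G h) = 0") (auto simp: card_eq_0_iff)

lemma card_centralizer:
  assumes "h \<in> carrier G"
  shows "real (card {x \<in> carrier G. x \<otimes> h \<otimes> inv x = h}) = card (carrier G) / card (conj_class G h)"
  using card_conj_class_pos[OF assms] unfolding card_conj_class[OF assms, symmetric] by simp

text \<open>Column orthogonality for \<open>h\<close> and \<open>inv h\<close>: the characters are
  conjugate to each other, and the number counted is the order of the centralizer.\<close>

lemma sum_norm_irr_char_squared:
  assumes h: "h \<in> carrier G"
  shows "(\<Sum>C\<in>Irr G. (cmod (irr_char C h))\<^sup>2) = card (carrier G) / card (conj_class G h)"
proof -
  have "of_real (\<Sum>C\<in>Irr G. (cmod (irr_char C h))\<^sup>2) = (\<Sum>C\<in>Irr G. irr_char C h * irr_char C (inv h))"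
    unfolding of_real_sum by (intro sum.cong refl) (simp only: irr_char_inv h complex_norm_square)
  also have "\<dots> = of_real (card {x \<in> carrier G. x \<otimes> h \<otimes> inv x = h})"
    using sum_irr_char_mult[OF h inv_closed[OF h]] h by simp
  finally show ?thesis
    by (simp only: of_real_eq_iff card_centralizer[OF h])
qed

lemma sum_irr_dim_squared: "(\<Sum>C\<in>Irr G. (real (irr_dim G C))\<^sup>2) = card (carrier G)"
proof -
  have "conj_class G \<one> = {\<one>}"
    by (auto simp: conj_class_def intro!: exI[of _ \<one>])
  then show ?thesis
    using sum_norm_irr_char_squared[of \<one>] by (simp add: irr_char_one)
qed

lemma D_measure_le:
  assumes H: "H \<subseteq> carrier G"
  shows "D_measure G H \<le> (\<Sum>h\<in>H - {\<one>}. 1 / sqrt (card (conj_class G h)))"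
proof -
  let ?N = "real (card (carrier G))"
  have N: "?N > 0"
    using one_closed by (auto simp: card_gt_0_iff)
  have "(\<Sum>C\<in>Irr G. real (irr_dim G C) * cmod (\<Sum>h\<in>H - {\<one>}. irr_char C h))
      \<le> (\<Sum>C\<in>Irr G. \<Sum>h\<in>H - {\<one>}. real (irr_dim G C) * cmod (irr_char C h))"
    unfolding sum_distrib_left[symmetric] by (intro sum_mono mult_left_mono norm_sum) auto
  also have "\<dots> = (\<Sum>h\<in>H - {\<one>}. \<Sum>C\<in>Irr G. real (irr_dim G C) * cmod (irr_char C h))"
    by (rule sum.swap)
  also have "\<dots> \<le> (\<Sum>h\<in>H - {\<one>}. ?N * (1 / sqrt (card (conj_class G h))))"
  proof (rule sum_mono)
    fix h assume "h \<in> H - {\<one>}"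
    then have h: "h \<in> carrier G"
      using H by auto
    have "(\<Sum>C\<in>Irr G. real (irr_dim G C) * cmod (irr_char C h))
        \<le> sqrt (\<Sum>C\<in>Irr G. (real (irr_dim G C))\<^sup>2) * sqrt (\<Sum>C\<in>Irr G. (cmod (irr_char C h))\<^sup>2)"
      using L2_set_mult_ineq[of "\<lambda>C. real (irr_dim G C)" "\<lambda>C. cmod (irr_char C h)" "Irr G"]
      by (simp add: L2_set_def)
    \<comment> \<open>The two square roots are those of \<open>?N\<close> and of \<open>?N\<close>
      divided by the class size.\<close>
    also have "\<dots> = ?N * (1 / sqrt (card (conj_class G h)))"
      using N by (simp add: sum_irr_dim_squared sum_norm_irr_char_squared[OF h] real_sqrt_divide)
    finally show "(\<Sum>C\<in>Irr G. real (irr_dim G C) * cmod (irr_char C h))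
        \<le> ?N * (1 / sqrt (card (conj_class G h)))" .
  qed
  finally show ?thesis
    using N unfolding D_measure_def sum_distrib_left[symmetric] by (simp add: field_simps)
qed

lemma D_measure_ge:
  assumes H: "H \<subseteq> carrier G" and h: "h \<in> H" "h \<noteq> \<one>"
  shows "1 / card (conj_class G h) \<le> D_measure G H"
proof -
  let ?N = "real (card (carrier G))"
  have N: "?N > 0"
    using one_closed by (auto simp: card_gt_0_iff)
  have hG: "h \<in> carrier G"
    using H h by auto
  have fin: "finite (H - {\<one>})"
    using H finite_subset[OF _ finite_carrier] by blast
  \<comment> \<open>\<open>?c k\<close> vanishes unless \<open>k\<close> is conjugate to
    \<open>h\<close>, and \<open>?c h\<close> is the order of the centralizer. Being nonnegative,
    these counts cannot cancel in the sum over \<open>k\<close>.\<close>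
  let ?c = "\<lambda>k. card {x \<in> carrier G. x \<otimes> k \<otimes> inv x = h}"
  have "?N / card (conj_class G h) = real (?c h)"
    by (rule card_centralizer[OF hG, symmetric])
  also have "\<dots> \<le> real (\<Sum>k\<in>H - {\<one>}. ?c k)"
    using member_le_sum[of h "H - {\<one>}" ?c] h fin by (simp del: of_nat_sum)
  also have "\<dots> = cmod (\<Sum>k\<in>H - {\<one>}. of_nat (?c k))"
    by (simp only: norm_of_nat flip: of_nat_sum)
  \<comment> \<open>Column orthogonality is applied with \<open>inv h\<close> as second argument, so
    that the conjugates are compared with \<open>h\<close> itself.\<close>
  also have "(\<Sum>k\<in>H - {\<one>}. of_nat (?c k)) = (\<Sum>k\<in>H - {\<one>}. \<Sum>C\<in>Irr G. irr_char C k * irr_char C (inv h))"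
    using H hG by (intro sum.cong refl) (auto simp: sum_irr_char_mult)
  also have "\<dots> = (\<Sum>C\<in>Irr G. irr_char C (inv h) * (\<Sum>k\<in>H - {\<one>}. irr_char C k))"
    by (subst sum.swap) (simp add: sum_distrib_left mult.commute)
  also have "cmod \<dots> \<le> (\<Sum>C\<in>Irr G. cmod (irr_char C (inv h)) * cmod (\<Sum>k\<in>H - {\<one>}. irr_char C k))"
    using norm_sum[of "\<lambda>C. irr_char C (inv h) * (\<Sum>k\<in>H - {\<one>}. irr_char C k)" "Irr G"]
    by (simp add: norm_mult)
  also have "\<dots> \<le> (\<Sum>C\<in>Irr G. real (irr_dim G C) * cmod (\<Sum>k\<in>H - {\<one>}. irr_char C k))"
    using hG by (intro sum_mono mult_right_mono norm_irr_char_le) auto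
  also have "\<dots> = ?N * D_measure G H"
    using N by (auto simp: D_measure_def)
  finally have "?N * (1 / card (conj_class G h)) \<le> ?N * D_measure G H"
    by simp
  then show ?thesis
    using N by (simp only: mult_le_cancel_left_pos)
qed

end

section \<open>From single pairs to families\<close>

theorem theorem3:
  fixes \<beta> :: real
    and I :: "'i set"
    and G :: "'i \<Rightarrow> ('a, 'm) monoid_scheme"
    and H :: "'i \<Rightarrow> 'a set"
  assumes "\<beta> > 1"
    and "\<And>i. i \<in> I \<Longrightarrow> group (G i)"
    and "\<And>i. i \<in> I \<Longrightarrow> finite (carrier (G i))"
    and "\<And>i. i \<in> I \<Longrightarrow> carrier (G i) \<noteq> {\<one>\<^bsub>G i\<^esub>}"
    and "\<And>i. i \<in> I \<Longrightarrow> subgroup (H i) (G i)"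
    and "\<exists>c::real. \<forall>i\<in>I. real (card (H i)) \<le> log \<beta> (real (card (carrier (G i)))) powr c"
  shows "distinguishable \<beta> I G H \<longleftrightarrow>
    (\<exists>c'::real. \<forall>i\<in>I. \<exists>h\<in>H i. h \<noteq> \<one>\<^bsub>G i\<^esub> \<and>
       real (card (conj_class (G i) h)) \<le> log \<beta> (real (card (carrier (G i)))) powr c')"
proof -
  let ?L = "\<lambda>i. log \<beta> (real (card (carrier (G i))))"
  have fg: "finite_group (G i)" if "i \<in> I" for i
    using assms(2,3)[OF that] by (simp add: finite_group_def finite_group_axioms_def)
  have sub: "H i \<subseteq> carrier (G i)" "\<one>\<^bsub>G i\<^esub> \<in> H i" if "i \<in> I" for i
    using assms(5)[OF that] by (auto simp: subgroup_def)
  \<comment> \<open>A group with at least two elements has a positive logarithm, so its real powers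
    are positive. The logarithm may still be below 1, hence the exponents below are matched exactly
    rather than enlarged.\<close>
  have L: "?L i > 0" if i: "i \<in> I" for i
  proof -
    interpret finite_group "G i" by (rule fg[OF i])
    have "card {\<one>\<^bsub>G i\<^esub>} < card (carrier (G i))"
      using assms(4)[OF i] by (intro psubset_card_mono) auto
    then show ?thesis
      using \<open>\<beta> > 1\<close> by simp
  qed
  obtain c where c: "\<And>i. i \<in> I \<Longrightarrow> real (card (H i)) \<le> ?L i powr c"
    using assms(6) by blast
  show ?thesis
  proof
    assume "distinguishable \<beta> I G H"
    then obtain b where b: "\<And>i. i \<in> I \<Longrightarrow> ?L i powr (- b) \<le> D_measure (G i) (H i)"
      by (auto simp: distinguishable_def)
    \<comment> \<open>The square root in the upper bound halves the exponent, and summing over at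
      most \<open>?L i powr c\<close> elements costs another \<open>c\<close>;
      \<open>2 * (b + c)\<close> compensates for both.\<close>
    have "\<exists>h\<in>H i. h \<noteq> \<one>\<^bsub>G i\<^esub> \<and> real (card (conj_class (G i) h)) \<le> ?L i powr (2 * (b + c))"
      if i: "i \<in> I" for i
    proof (rule ccontr)
      interpret finite_group "G i" by (rule fg[OF i])
      assume "\<not> ?thesis"
      then have large: "?L i powr (2 * (b + c)) \<le> card (conj_class (G i) h)"
        if "h \<in> H i - {\<one>\<^bsub>G i\<^esub>}" for h
        using that by force
      have fin: "finite (H i)"
        using finite_subset[OF sub(1)[OF i]] by simp
      have "D_measure (G i) (H i) \<le> (\<Sum>h\<in>H i - {\<one>\<^bsub>G i\<^esub>}. 1 / sqrt (card (conj_class (G i) h)))"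
        by (rule D_measure_le[OF sub(1)[OF i]])
      also have "\<dots> \<le> (\<Sum>h\<in>H i - {\<one>\<^bsub>G i\<^esub>}. ?L i powr - (b + c))"
      proof (rule sum_mono)
        fix h assume h: "h \<in> H i - {\<one>\<^bsub>G i\<^esub>}"
        have "?L i powr (b + c) = sqrt (?L i powr (2 * (b + c)))"
          by (simp only: mult_2 powr_add real_sqrt_abs2 abs_of_nonneg mult_nonneg_nonneg powr_ge_zero)
        also have "\<dots> \<le> sqrt (card (conj_class (G i) h))"
          using large[OF h] by simp
        finally have "1 / sqrt (card (conj_class (G i) h)) \<le> 1 / ?L i powr (b + c)"
          using L[OF i] by (intro frac_le) auto
        then show "1 / sqrt (card (conj_class (G i) h)) \<le> ?L i powr - (b + c)"
          by (simp only: powr_minus_divide)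
      qed
      also have "\<dots> = card (H i - {\<one>\<^bsub>G i\<^esub>}) * ?L i powr - (b + c)"
        by simp
      \<comment> \<open>Dropping \<one> from \<open>H i\<close> makes the inequality strict, which
        is what contradicts the weak bound \<open>b\<close>. This also covers a trivial
        \<open>H i\<close>, where the sum is empty.\<close>
      also have "\<dots> < card (H i) * ?L i powr - (b + c)"
        using card_Diff1_less[OF fin sub(2)[OF i]] L[OF i] by (intro mult_strict_right_mono) auto
      also have "\<dots> \<le> ?L i powr c * ?L i powr - (b + c)"
        using c[OF i] by (intro mult_right_mono) auto
      also have "\<dots> = ?L i powr - b"
        by (simp add: powr_add[symmetric])
      finally show False
        using b[OF i] by simp
    qed
    then show "\<exists>c'. \<forall>i\<in>I. \<exists>h\<in>H i. h \<noteq> \<one>\<^bsub>G i\<^esub> \<and> real (card (conj_class (G i) h)) \<le> ?L i powr c'"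
      by blast
  next
    assume "\<exists>c'. \<forall>i\<in>I. \<exists>h\<in>H i. h \<noteq> \<one>\<^bsub>G i\<^esub> \<and> real (card (conj_class (G i) h)) \<le> ?L i powr c'"
    then obtain c' where c': "\<And>i. i \<in> I \<Longrightarrow> \<exists>h\<in>H i. h \<noteq> \<one>\<^bsub>G i\<^esub> \<and>
        real (card (conj_class (G i) h)) \<le> ?L i powr c'"
      by blast
    \<comment> \<open>The lower bound is the reciprocal of a class size, so the exponent
      \<open>c'\<close> itself serves as \<open>b\<close>.\<close>
    have "?L i powr (- c') \<le> D_measure (G i) (H i)" if i: "i \<in> I" for i
    proof -
      interpret finite_group "G i" by (rule fg[OF i])
      obtain h where h: "h \<in> H i" "h \<noteq> \<one>\<^bsub>G i\<^esub>" "real (card (conj_class (G i) h)) \<le> ?L i powr c'"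
        using c'[OF i] by blast
      then have "0 < card (conj_class (G i) h)"
        using sub(1)[OF i] by (intro card_conj_class_pos) auto
      then have "1 / ?L i powr c' \<le> 1 / card (conj_class (G i) h)"
        using h(3) by (intro divide_left_mono mult_pos_pos) auto
      also have "\<dots> \<le> D_measure (G i) (H i)"
        by (rule D_measure_ge[OF sub(1)[OF i] h(1,2)])
      finally show ?thesis
        by (simp only: powr_minus_divide)
    qed
    then show "distinguishable \<beta> I G H"
      by (auto simp: distinguishable_def)
  qed
qed

end
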